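(* Let $G$ be a finite simple graph that is connected and vertex-transitive, of odd order $|V(G)|\geq 5$. Then $G$ is 3-factor-critical if and only if $G$ is not a cycle.
   Context: The order of a graph $G$ is $|V(G)|$. $G$ is vertex-transitive if for any two vertices $x,y$ of $G$ there is an automorphism $\varphi$ of $G$ with $y=\varphi(x)$. A perfect matching of a graph is a set of independent (pairwise non-adjacent) edges covering all of its vertices. A graph $G$ of order $n$ is $p$-factor-critical, where $p$ is an integer of the same parity as $n$, if the removal of any set of $p$ vertices of $G$ results in a graph with a perfect matching. Here $p=3$. *)

theory Defs
  imports "Graph_Theory.Digraph_Isomorphism"
begin

text \<open>
  Finite simple graphs are the library's \<open>Digraph.graph\<close>: finite digraphs without loops or
  parallel arcs whose arc relation is symmetric. An undirected edge with ends \<open>u\<close>, \<open>v\<close>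
  is thus a pair of opposite arcs; it is represented below by the set \<open>{u, v}\<close>.
\<close>

definition edges :: "('a, 'b) pre_digraph \<Rightarrow> 'a set set" where
  "edges G = {{tail G e, head G e} | e. e \<in> arcs G}"

definition automorphism ::
  "('a, 'b) pre_digraph \<Rightarrow> ('a, 'b, 'a, 'b) digraph_isomorphism \<Rightarrow> bool" where
  "automorphism G \<phi> \<longleftrightarrow> pre_digraph.digraph_isomorphism G \<phi> \<and> app_iso \<phi> G = G"

definition vertex_transitive :: "('a, 'b) pre_digraph \<Rightarrow> bool" where
  "vertex_transitive G \<longleftrightarrow>
    (\<forall>x \<in> verts G. \<forall>y \<in> verts G. \<exists>\<phi>. automorphism G \<phi> \<and> y = iso_verts \<phi> x)"

definition perfect_matching :: "('a, 'b) pre_digraph \<Rightarrow> 'a set set \<Rightarrow> bool" where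
  "perfect_matching G M \<longleftrightarrow> M \<subseteq> edges G \<and> pairwise disjnt M \<and> \<Union>M = verts G"

definition factor_critical :: "nat \<Rightarrow> ('a, 'b) pre_digraph \<Rightarrow> bool" where
  "factor_critical p G \<longleftrightarrow>
    (even p \<longleftrightarrow> even (card (verts G))) \<and>
    (\<forall>S. S \<subseteq> verts G \<and> card S = p \<longrightarrow> (\<exists>M. perfect_matching (G \<restriction> (verts G - S)) M))"

definition cycle_graph :: "nat \<Rightarrow> nat pair_pre_digraph" where
  "cycle_graph n = \<lparr> pverts = {..<n},
     parcs = {(i, j). i < n \<and> j < n \<and> (j = Suc i mod n \<or> i = Suc j mod n)} \<rparr>"

text \<open>The bound excludes the degenerate cases of a loop and of a single edge.\<close>

definition is_cycle :: "('a, 'b) pre_digraph \<Rightarrow> bool" where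
  "is_cycle G \<longleftrightarrow> (\<exists>n \<ge> 3. digraph_iso G (with_proj (cycle_graph n)))"

end

theory Submission
  imports Defs
begin

text \<open>
  The graph is regular, of degree \<open>k\<close> say, and \<open>k\<close> is even because the order is odd. If \<open>k = 2\<close>, then
  the graph is a cycle; deleting the two neighbours of a vertex and a third vertex isolates that
  vertex, so a cycle is not 3-factor-critical. Connectedness excludes \<open>k = 0\<close>, so it remains to treat
  \<open>k \<ge> 4\<close>.

  Suppose that deleting a set \<open>S\<close> of three vertices leaves no perfect matching. Tutte's theorem
  (\<open>tutte_barrier\<close>) and parity yield a set \<open>X\<close> containing \<open>S\<close> and at least \<open>|X| - 1\<close> disjoint odd
  pieces of the rest, all of whose outgoing edges end in \<open>X\<close>. At most \<open>k|X|\<close> edges leave \<open>X\<close>. A piece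
  consisting of one vertex receives \<open>k\<close> of them, and every other piece receives at least \<open>2k - 2\<close>
  (\<open>cut_ge\<close>). Comparing the counts, at most two pieces have more than one vertex, and if there are
  two of them, then \<open>k = 4\<close>, each of them receives exactly six edges, and \<open>X\<close> is independent.

  Let \<open>Y\<close> be the set of the vertices that are pieces on their own. All neighbours of \<open>Y\<close> are in \<open>X\<close>,
  but a nonempty \<open>Y\<close> has at least \<open>|Y| + 3\<close> neighbours (\<open>card_nbrs_ge\<close>). As \<open>|X| \<ge> 3\<close>, this leaves
  only the case of two larger pieces. There, if \<open>Y\<close> is empty, then \<open>X\<close> has three vertices and separates
  the two pieces, which \<open>card_closed_nbrs_ge\<close> forbids in degree four. If \<open>Y\<close> is nonempty, its members
  lie in no triangle, since their neighbours belong to the independent set \<open>X\<close>; by transitivity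
  there is no triangle at all, whereas a larger piece with only six outgoing edges forces one
  (\<open>ex_triangle\<close>).

  The estimates all rest on one idea. The number of edges leaving a set, and the excess of the number
  of its neighbours over its size, are submodular. So if a set of smallest size among those that
  minimize such a function meets another image of itself under an automorphism, then the
  intersection (for edge cuts, the intersection or the difference) is a smaller minimizer. Apart
  from tiny sets, the images are thus disjoint and form a system of blocks, whose common size divides
  the odd order of the graph; parity and divisibility then exclude small values.
\<close>


section \<open>Tutte's theorem\<close>

text \<open>
  The classical induction: if some proper nonempty subfamily is tight, match it first, and the rest
  keeps Hall's condition outside the union of the subfamily. If none is tight, then the condition
  has a surplus, and any single choice can be fixed.
\<close>
theorem hall_marriage:
  assumes "finite I" and "\<And>i. i \<in> I \<Longrightarrow> finite (A i)"
    and "\<And>J. J \<subseteq> I \<Longrightarrow> card J \<le> card (\<Union>i\<in>J. A i)"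
  shows "\<exists>f. inj_on f I \<and> (\<forall>i\<in>I. f i \<in> A i)"
  using assms
proof (induction "card I" arbitrary: I A rule: less_induct)
  case less
  note fin = less.prems(1) and finA = less.prems(2) and hall = less.prems(3)
  show ?case
  proof (cases "\<exists>J. J \<subset> I \<and> J \<noteq> {} \<and> card (\<Union>i\<in>J. A i) = card J")
    case True
    then obtain J where J: "J \<subset> I" "J \<noteq> {}" "card (\<Union>i\<in>J. A i) = card J" by blast
    let ?U = "\<Union>i\<in>J. A i"
    have finJ: "finite J" using J(1) fin finite_subset by blast
    then have "finite ?U" using J(1) finA by auto
    have "\<exists>f. inj_on f J \<and> (\<forall>i\<in>J. f i \<in> A i)"
    proof (rule less.hyps)
      show "card J < card I" using J fin by (simp add: psubset_card_mono)
    qed (use J finA finJ hall in auto)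
    then obtain f where f: "inj_on f J" "\<And>i. i \<in> J \<Longrightarrow> f i \<in> A i" by blast
    have "\<exists>g. inj_on g (I - J) \<and> (\<forall>i\<in>I - J. g i \<in> A i - ?U)"
    proof (rule less.hyps)
      show "card (I - J) < card I"
        by (rule psubset_card_mono) (use J fin in auto)
      fix K assume K: "K \<subseteq> I - J"
      have "card K + card J = card (K \<union> J)"
        using K finJ fin by (subst card_Un_disjoint) (auto intro: finite_subset)
      also have "\<dots> \<le> card (\<Union>i\<in>K \<union> J. A i)" using K J by (intro hall) auto
      also have "(\<Union>i\<in>K \<union> J. A i) = (\<Union>i\<in>K. A i - ?U) \<union> ?U" by auto
      also have "card \<dots> \<le> card (\<Union>i\<in>K. A i - ?U) + card ?U" by (rule card_Un_le)
      finally show "card K \<le> card (\<Union>i\<in>K. A i - ?U)" using J by simp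
    qed (use fin finA in auto)
    then obtain g where g: "inj_on g (I - J)" "\<And>i. i \<in> I - J \<Longrightarrow> g i \<in> A i - ?U" by blast
    let ?h = "\<lambda>i. if i \<in> J then f i else g i"
    have "inj_on ?h I"
    proof (rule inj_onI)
      fix x y assume xy: "x \<in> I" "y \<in> I" "?h x = ?h y"
      show "x = y"
        using xy f(1) g(1) f(2)[of x] f(2)[of y] g(2)[of x] g(2)[of y]
        by (cases "x \<in> J"; cases "y \<in> J") (auto dest: inj_onD)
    qed
    moreover have "\<forall>i\<in>I. ?h i \<in> A i" using f g by auto
    ultimately show ?thesis by blast
  next
    case False
    show ?thesis
    proof (cases "I = {}")
      case False
      then obtain i where i: "i \<in> I" by blast
      have "card {i} \<le> card (\<Union>j\<in>{i}. A j)" using i by (intro hall) auto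
      then obtain a where a: "a \<in> A i" by fastforce
      have "\<exists>f. inj_on f (I - {i}) \<and> (\<forall>j\<in>I - {i}. f j \<in> A j - {a})"
      proof (rule less.hyps)
        show "card (I - {i}) < card I" using i fin by (metis card_Diff1_less)
        fix K assume K: "K \<subseteq> I - {i}"
        show "card K \<le> card (\<Union>j\<in>K. A j - {a})"
        proof (cases "K = {}")
          case False
          have KI: "K \<subset> I" using K i by auto
          have "card K \<le> card (\<Union>j\<in>K. A j)" using KI by (intro hall) auto
          moreover have "card (\<Union>j\<in>K. A j) \<noteq> card K"
            using \<open>\<not> (\<exists>J. _ J)\<close> KI False by blast
          moreover have "(\<Union>j\<in>K. A j - {a}) = (\<Union>j\<in>K. A j) - {a}" by auto
          moreover have "card (\<Union>j\<in>K. A j) \<le> Suc (card ((\<Union>j\<in>K. A j) - {a}))"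
            by (simp add: card_Diff_singleton_if) arith
          ultimately show ?thesis by simp
        qed simp
      qed (use fin finA in auto)
      then obtain f where f: "inj_on f (I - {i})" "\<And>j. j \<in> I - {i} \<Longrightarrow> f j \<in> A j - {a}" by blast
      have "inj_on (f(i := a)) I"
      proof (rule inj_onI)
        fix x y assume xy: "x \<in> I" "y \<in> I" "(f(i := a)) x = (f(i := a)) y"
        show "x = y"
          using xy f(1) f(2)[of x] f(2)[of y]
          by (cases "x = i"; cases "y = i") (auto dest: inj_onD)
      qed
      moreover have "\<forall>j\<in>I. (f(i := a)) j \<in> A j" using f a by auto
      ultimately show ?thesis by blast
    qed simp
  qed
qed

definition matchable :: "'a rel \<Rightarrow> 'a set \<Rightarrow> bool" where
  "matchable E W \<longleftrightarrow>
    (\<exists>M. M \<subseteq> {{x, y} | x y. (x, y) \<in> E} \<and> pairwise disjnt M \<and> \<Union>M = W)"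

text \<open>
  In Tutte's theorem the sets in \<open>\<C>\<close> are odd components of \<open>W - T\<close>. Dropping the requirement that they
  be connected, and that all odd components be listed, does not change the condition of the theorem,
  because an odd union of components contains an odd component. It spares all reasoning about
  components.
\<close>
definition odd_parts :: "'a rel \<Rightarrow> 'a set \<Rightarrow> 'a set \<Rightarrow> 'a set set \<Rightarrow> bool" where
  "odd_parts E W T \<C> \<longleftrightarrow> pairwise disjnt \<C> \<and>
    (\<forall>C\<in>\<C>. odd (card C) \<and> C \<subseteq> W - T \<and> E `` C \<inter> W \<subseteq> C \<union> T)"

lemma matchable_edge: "(x, y) \<in> E \<Longrightarrow> matchable E {x, y}"
  unfolding matchable_def by (intro exI[of _ "{{x, y}}"]) auto

lemma matchable_Union:
  assumes "pairwise disjnt \<P>" and "\<And>P. P \<in> \<P> \<Longrightarrow> matchable E P"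
  shows "matchable E (\<Union>\<P>)"
proof -
  define F where "F = {{x, y} | x y. (x, y) \<in> E}"
  have "\<exists>M. \<forall>P\<in>\<P>. M P \<subseteq> F \<and> pairwise disjnt (M P) \<and> \<Union>(M P) = P"
    using assms(2) unfolding matchable_def F_def[symmetric] by (intro bchoice) auto
  then obtain M where M: "\<And>P. P \<in> \<P> \<Longrightarrow> M P \<subseteq> F"
    "\<And>P. P \<in> \<P> \<Longrightarrow> pairwise disjnt (M P)" "\<And>P. P \<in> \<P> \<Longrightarrow> \<Union>(M P) = P" by metis
  have "pairwise disjnt (\<Union>P\<in>\<P>. M P)"
  proof (rule pairwiseI)
    fix m m' assume "m \<in> (\<Union>P\<in>\<P>. M P)" "m' \<in> (\<Union>P\<in>\<P>. M P)" "m \<noteq> m'"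
    then obtain P P' where P: "P \<in> \<P>" "m \<in> M P" "P' \<in> \<P>" "m' \<in> M P'" by auto
    show "disjnt m m'"
    proof (cases "P = P'")
      case True then show ?thesis using P M(2) \<open>m \<noteq> m'\<close> by (metis pairwiseD)
    next
      case False
      then have "disjnt P P'" using P assms(1) by (metis pairwiseD)
      moreover have "m \<subseteq> P" "m' \<subseteq> P'" using M(3) P by auto
      ultimately show ?thesis by (meson disjnt_subset1 disjnt_subset2)
    qed
  qed
  moreover have "\<Union>(\<Union>P\<in>\<P>. M P) = (\<Union>P\<in>\<P>. \<Union>(M P))" by blast
  then have "\<Union>(\<Union>P\<in>\<P>. M P) = \<Union>\<P>" using M(3) by simp
  moreover have "(\<Union>P\<in>\<P>. M P) \<subseteq> F" using M(1) by (rule UN_least)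
  ultimately show ?thesis
    unfolding matchable_def F_def[symmetric] by (intro exI[of _ "\<Union>P\<in>\<P>. M P"] conjI)
qed

lemma even_card_Union_odd:
  assumes "finite \<C>" "pairwise disjnt \<C>" "\<And>C. C \<in> \<C> \<Longrightarrow> odd (card C)"
  shows "even (card (\<Union>\<C>)) \<longleftrightarrow> even (card \<C>)"
proof -
  have "card (\<Union>\<C>) = sum card \<C>"
    using assms by (intro card_Union_disjoint) (metis card.infinite even_zero)+
  moreover have "even (sum card \<C>) \<longleftrightarrow> even (card \<C>)"
    using assms(1,3) by (induction \<C> rule: finite_induct) auto
  ultimately show ?thesis by simp
qed

lemma odd_parts_finite:
  assumes "odd_parts E W T \<C>" "finite W"
  shows "finite \<C>"
  using assms unfolding odd_parts_def by (intro finite_subset[of \<C> "Pow W"]) auto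

lemma odd_parts_leftover_parity:
  assumes "odd_parts E W T \<C>" "finite W" "T \<subseteq> W"
  shows "even (card (W - T - \<Union>\<C>)) \<longleftrightarrow> even (card W + card T + card \<C>)"
proof -
  have fin: "finite \<C>" "finite T" "finite (\<Union>\<C>)"
    using assms odd_parts_finite[OF assms(1,2)] finite_subset[of "\<Union>\<C>" W] finite_subset[of T W]
    unfolding odd_parts_def by auto
  have "\<Union>\<C> \<subseteq> W - T" using assms unfolding odd_parts_def by auto
  then have "card (W - T) = card (\<Union>\<C>) + card (W - T - \<Union>\<C>)"
    using assms(2) fin by (simp add: card_Diff_subset card_mono)
  moreover have "card W = card T + card (W - T)"
    using assms(2,3) fin by (simp add: card_Diff_subset card_mono)
  ultimately have "card W = card T + card (\<Union>\<C>) + card (W - T - \<Union>\<C>)" by simp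
  moreover have "even (card (\<Union>\<C>)) \<longleftrightarrow> even (card \<C>)"
    using assms fin by (intro even_card_Union_odd) (auto simp: odd_parts_def)
  ultimately show ?thesis by presburger
qed

text \<open>
  By symmetry no edge leads from the uncovered vertices into a part, so if their number is odd
  they form a further part.
\<close>
lemma odd_parts_insert_leftover:
  assumes "odd_parts E W T \<C>" "finite W" "T \<subseteq> W" "sym E"
    and "odd (card (W - T - \<Union>\<C>))"
  shows "odd_parts E W T (insert (W - T - \<Union>\<C>) \<C>)"
    and "card (insert (W - T - \<Union>\<C>) \<C>) = Suc (card \<C>)"
proof -
  let ?L = "W - T - \<Union>\<C>"
  have "?L \<noteq> {}" using assms(5) by (metis card.empty even_zero)
  then have "?L \<notin> \<C>" by auto
  then show "card (insert ?L \<C>) = Suc (card \<C>)" using odd_parts_finite[OF assms(1,2)] by simp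
  have "E `` ?L \<inter> W \<subseteq> ?L \<union> T"
  proof
    fix y assume "y \<in> E `` ?L \<inter> W"
    then obtain x where x: "x \<in> ?L" "(x, y) \<in> E" "y \<in> W" by auto
    then have "(y, x) \<in> E" using assms(4) by (meson symD)
    show "y \<in> ?L \<union> T"
    proof (rule ccontr)
      assume "y \<notin> ?L \<union> T"
      then obtain C where "C \<in> \<C>" "y \<in> C" using x by auto
      then have "x \<in> C \<union> T" using assms(1) x \<open>(y, x) \<in> E\<close> unfolding odd_parts_def by blast
      then show False using x \<open>C \<in> \<C>\<close> by auto
    qed
  qed
  then show "odd_parts E W T (insert ?L \<C>)"
    using assms(1,5) unfolding odd_parts_def
    by (auto simp: pairwise_insert disjnt_def)
qed

text \<open>
  In an even set a violation by one leaves an odd number of vertices uncovered, hence extends to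
  a violation by two.
\<close>
lemma odd_parts_excess_two:
  assumes "odd_parts E W T \<C>" "finite W" "T \<subseteq> W" "sym E" "even (card W)" "card T < card \<C>"
  obtains \<C>' where "odd_parts E W T \<C>'" "card T + 2 \<le> card \<C>'"
proof (cases "card \<C> = Suc (card T)")
  case True
  then have "odd (card (W - T - \<Union>\<C>))"
    using odd_parts_leftover_parity[OF assms(1-3)] assms(5) by simp
  then show ?thesis
    using odd_parts_insert_leftover[OF assms(1-4)] True that by (metis add_2_eq_Suc' order_refl)
next
  case False then show ?thesis using assms(1,6) that[of \<C>] by simp
qed

text \<open>
  Anderson's proof from Hall's theorem. Choose a largest \<open>T\<close> for which the bound is attained, by \<open>\<C>\<close>
  say. Maximality gives that \<open>\<C>\<close> covers \<open>W - T\<close> and, by induction, that each part has a perfect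
  matching after the removal of an arbitrary vertex. Hall's theorem matches the parts with \<open>T\<close>; the
  end in the part of each chosen edge is the vertex to be removed from it.
\<close>
theorem tutte:
  assumes "finite W" "sym E" 
    and "\<And>T \<C>. T \<subseteq> W \<Longrightarrow> odd_parts E W T \<C> \<Longrightarrow> card \<C> \<le> card T"
  shows "matchable E W"
  using assms(1,3)
proof (induction W rule: finite_psubset_induct)
  case (psubset W)
  note finW = psubset.hyps and tc = psubset.prems
  let ?tight = "\<lambda>T. T \<subseteq> W \<and> (\<exists>\<C>. odd_parts E W T \<C> \<and> card \<C> = card T)"
  have "?tight {}" by (auto simp: odd_parts_def intro!: exI[of _ "{}"])
  then have "\<exists>T. ?tight T \<and> (\<forall>T'. ?tight T' \<longrightarrow> card T' \<le> card T)"
    using finW by (intro ex_has_greatest_nat[of _ "{}" _ "Suc (card W)"])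
      (auto simp: less_Suc_eq_le intro: card_mono)
  then obtain T \<C> where T: "T \<subseteq> W" "odd_parts E W T \<C>" "card \<C> = card T"
    and Tmax: "\<And>T'. ?tight T' \<Longrightarrow> card T' \<le> card T" by blast
  have Cfin: "finite \<C>" and Tfin: "finite T"
    using T finW odd_parts_finite finite_subset by blast+
  have Cdisj: "pairwise disjnt \<C>" and Codd: "\<And>C. C \<in> \<C> \<Longrightarrow> odd (card C)"
    and Csub: "\<And>C. C \<in> \<C> \<Longrightarrow> C \<subseteq> W - T" and Ccl: "\<And>C. C \<in> \<C> \<Longrightarrow> E `` C \<inter> W \<subseteq> C \<union> T"
    using T(2) unfolding odd_parts_def by auto
  have evenW: "even (card W)"
  proof (rule ccontr)
    assume "odd (card W)"
    then have "odd_parts E W {} {W}" by (auto simp: odd_parts_def)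
    then show False using tc[of "{}" "{W}"] by simp
  qed
  \<comment> \<open>Otherwise the leftover is even, and moving one of its vertices into \<open>T\<close> makes it an odd part.\<close>
  have cover: "W - T - \<Union>\<C> = {}"
  proof (rule ccontr)
    let ?L = "W - T - \<Union>\<C>"
    assume "?L \<noteq> {}"
    then obtain v where v: "v \<in> ?L" by blast
    have "even (card ?L)"
      using odd_parts_leftover_parity[OF T(2) finW T(1)] evenW T(3) by simp
    then have odd: "odd (card (?L - {v}))"
      using v finW by (metis card_Suc_Diff1 finite_Diff even_Suc)
    have op: "odd_parts E W (insert v T) \<C>"
      using T(2) v unfolding odd_parts_def by auto
    have eq: "W - insert v T - \<Union>\<C> = ?L - {v}" by auto
    have "odd_parts E W (insert v T) (insert (?L - {v}) \<C>)"
      "card (insert (?L - {v}) \<C>) = Suc (card \<C>)"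
      using odd_parts_insert_leftover[OF op finW _ assms(2)] odd v T(1) unfolding eq by auto
    then have "?tight (insert v T)" using v T Tfin by auto
    then show False using Tmax[of "insert v T"] v Tfin by auto
  qed
  \<comment> \<open>A violation inside \<open>C - {v}\<close> is by at least two, for parity reasons; added to \<open>T\<close> and \<open>v\<close> it would
    give a larger tight set.\<close>
  have part: "matchable E (C - {v})" if C: "C \<in> \<C>" and v: "v \<in> C" for C v
  proof (rule psubset.IH)
    show "C - {v} \<subset> W" using Csub[OF C] v by auto
    fix T' \<D> assume T': "T' \<subseteq> C - {v}" and D: "odd_parts E (C - {v}) T' \<D>"
    show "card \<D> \<le> card T'"
    proof (rule ccontr)
      assume "\<not> card \<D> \<le> card T'"
      have finC: "finite C" using Csub[OF C] finW finite_subset by blast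
      have "even (card (C - {v}))" using Codd[OF C] v finC by (metis card_Suc_Diff1 even_Suc)
      then obtain \<D>' where D': "odd_parts E (C - {v}) T' \<D>'" "card T' + 2 \<le> card \<D>'"
        using odd_parts_excess_two[OF D _ T' assms(2)] finC \<open>\<not> card \<D> \<le> card T'\<close> by auto
      let ?T = "insert v (T \<union> T')" and ?C = "(\<C> - {C}) \<union> \<D>'"
      have T'fin: "finite T'" using T' finC finite_subset by blast
      have TC: "T \<inter> C = {}" using Csub[OF C] by auto
      have Dsub: "D \<subseteq> C" "D \<noteq> {}" if "D \<in> \<D>'" for D
        using D'(1) that unfolding odd_parts_def by (auto simp: card_gt_0_iff)
      have disjC: "C' \<inter> C = {}" if "C' \<in> \<C>" "C' \<noteq> C" for C'
        using Cdisj that C by (metis pairwiseD disjnt_def)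
      have "odd_parts E W ?T ?C"
        unfolding odd_parts_def
      proof (intro conjI ballI)
        have "pairwise disjnt \<D>'" using D'(1) unfolding odd_parts_def by auto
        moreover have "disjnt K D" "disjnt D K" if "K \<in> \<C> - {C}" "D \<in> \<D>'" for K D
          using disjC[of K] Dsub(1)[of D] that unfolding disjnt_def by auto
        ultimately show "pairwise disjnt ?C"
          using Cdisj unfolding pairwise_def by (metis DiffD1 Un_iff)
        fix K assume K: "K \<in> ?C"
        show "odd (card K)" using K Codd D'(1) unfolding odd_parts_def by auto
        show "K \<subseteq> W - ?T"
        proof (cases "K \<in> \<D>'")
          case True
          then have "K \<subseteq> C - {v} - T'" using D'(1) unfolding odd_parts_def by auto
          then show ?thesis using Csub[OF C] by auto
        next
          case False
          then show ?thesis using K Csub[of K] disjC[of K] T' v by auto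
        qed
        show "E `` K \<inter> W \<subseteq> K \<union> ?T"
        proof (cases "K \<in> \<D>'")
          case True
          then have "E `` K \<inter> (C - {v}) \<subseteq> K \<union> T'" using D'(1) unfolding odd_parts_def by auto
          moreover have "E `` K \<inter> W \<subseteq> C \<union> T" using Ccl[OF C] Dsub[OF True] by auto
          ultimately show ?thesis by auto
        next
          case False
          then show ?thesis using K Ccl[of K] by auto
        qed
      qed
      moreover have subT: "?T \<subseteq> W" using T(1) T' v Csub[OF C] by auto
      ultimately have le: "card ?C \<le> card ?T" by (intro tc)
      have D'fin: "finite \<D>'" using odd_parts_finite[OF D'(1)] finC by auto
      have "card ?C = card (\<C> - {C}) + card \<D>'"
      proof (rule card_Un_disjoint)
        have "D \<notin> \<D>'" if "D \<in> \<C> - {C}" for D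
          using disjC[of D] Dsub[of D] that by auto
        then show "(\<C> - {C}) \<inter> \<D>' = {}" by auto
      qed (use Cfin D'fin in auto)
      moreover have "card ?T = Suc (card T + card T')"
      proof -
        have "T \<inter> T' = {}" "v \<notin> T \<union> T'" using T' v TC by auto
        then show ?thesis using Tfin T'fin by (simp add: card_Un_disjoint)
      qed
      moreover have "Suc (card (\<C> - {C})) = card T"
        using card_Suc_Diff1[OF Cfin C] T(3) by simp
      ultimately have "card ?C = card ?T" "card T < card ?T" using le D'(2) by auto
      moreover have "?tight ?T"
        using subT \<open>odd_parts E W ?T ?C\<close> \<open>card ?C = card ?T\<close> by blast
      ultimately show False using Tmax[of ?T] by simp
    qed
  qed
  have "\<exists>f. inj_on f \<C> \<and> (\<forall>C\<in>\<C>. f C \<in> E `` C \<inter> T)"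
  proof (rule hall_marriage)
    fix J assume J: "J \<subseteq> \<C>"
    show "card J \<le> card (\<Union>C\<in>J. E `` C \<inter> T)"
    proof (rule tc)
      show "(\<Union>C\<in>J. E `` C \<inter> T) \<subseteq> W" using T(1) by auto
      have "pairwise disjnt J" using Cdisj J by (meson pairwise_subset)
      then show "odd_parts E W (\<Union>C\<in>J. E `` C \<inter> T) J"
        unfolding odd_parts_def
      proof (intro conjI ballI)
        fix K assume "K \<in> J"
        then have K: "K \<in> \<C>" using J by auto
        show "odd (card K)" using Codd[OF K] .
        show "K \<subseteq> W - (\<Union>C\<in>J. E `` C \<inter> T)" using Csub[OF K] by auto
        show "E `` K \<inter> W \<subseteq> K \<union> (\<Union>C\<in>J. E `` C \<inter> T)" using Ccl[OF K] \<open>K \<in> J\<close> by auto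
      qed
    qed
  qed (use Cfin Tfin in auto)
  then obtain f where f: "inj_on f \<C>" "\<And>C. C \<in> \<C> \<Longrightarrow> f C \<in> E `` C \<inter> T" by blast
  then have "f ` \<C> \<subseteq> T" by auto
  then have fT: "f ` \<C> = T" using f(1) T(3) Tfin by (metis card_image card_subset_eq)
  have "\<forall>C\<in>\<C>. \<exists>v. v \<in> C \<and> (v, f C) \<in> E" using f(2) by auto
  then obtain g where g: "\<And>C. C \<in> \<C> \<Longrightarrow> g C \<in> C \<and> (g C, f C) \<in> E" by metis
  have "matchable E (insert (f C) C)" if C: "C \<in> \<C>" for C
  proof -
    have "f C \<notin> C" using f(2)[OF C] Csub[OF C] by auto
    then have "pairwise disjnt {{g C, f C}, C - {g C}}"
      using g[OF C] by (auto simp: pairwise_insert disjnt_def)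
    then have "matchable E (\<Union>{{g C, f C}, C - {g C}})"
      using part[OF C, of "g C"] g[OF C] by (intro matchable_Union) (auto intro: matchable_edge)
    moreover have "\<Union>{{g C, f C}, C - {g C}} = insert (f C) C" using g[OF C] by auto
    ultimately show ?thesis by simp
  qed
  moreover have "pairwise disjnt ((\<lambda>C. insert (f C) C) ` \<C>)"
  proof (rule pairwiseI)
    fix P Q assume "P \<in> (\<lambda>C. insert (f C) C) ` \<C>" "Q \<in> (\<lambda>C. insert (f C) C) ` \<C>" "P \<noteq> Q"
    then obtain C D where CD: "C \<in> \<C>" "D \<in> \<C>" "C \<noteq> D" "P = insert (f C) C" "Q = insert (f D) D"
      by auto
    have "C \<inter> D = {}" using Cdisj CD by (metis pairwiseD disjnt_def)
    moreover have "f C \<noteq> f D" using f(1) CD by (metis inj_onD)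
    moreover have "f C \<notin> D" "f D \<notin> C" using f(2) Csub CD by auto
    ultimately show "disjnt P Q" unfolding CD(4,5) disjnt_def by auto
  qed
  ultimately have "matchable E (\<Union>((\<lambda>C. insert (f C) C) ` \<C>))" by (intro matchable_Union) auto
  moreover have "\<Union>((\<lambda>C. insert (f C) C) ` \<C>) = W"
    using fT cover Csub T(1) by auto
  ultimately show ?case by simp
qed

corollary tutte_barrier:
  assumes "finite W" "sym E" "even (card W)" "\<not> matchable E W"
  obtains T \<C> where "T \<subseteq> W" "odd_parts E W T \<C>" "card T + 2 \<le> card \<C>"
proof -
  obtain T \<C> where T: "T \<subseteq> W" "odd_parts E W T \<C>" "card T < card \<C>"
    using tutte[OF assms(1,2)] assms(4) by (metis not_le)
  obtain \<C>' where "odd_parts E W T \<C>'" "card T + 2 \<le> card \<C>'"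
    using odd_parts_excess_two[OF T(2) assms(1) T(1) assms(2,3) T(3)] .
  then show ?thesis using that T(1) by blast
qed

section \<open>Blocks and expansion in vertex-transitive relations\<close>

lemma card_add_mono:
  assumes "X \<union> Y \<subseteq> Z \<union> W" "X \<inter> Y \<subseteq> Z \<inter> W" "finite Z" "finite W"
  shows "card X + card Y \<le> card Z + card W"
proof -
  have "finite X" "finite Y" using assms(1,3,4) finite_subset[of _ "Z \<union> W"] by auto
  then have "card X + card Y = card (X \<union> Y) + card (X \<inter> Y)" by (rule card_Un_Int)
  also have "\<dots> \<le> card (Z \<union> W) + card (Z \<inter> W)"
    using assms by (intro add_mono card_mono) auto
  also have "\<dots> = card Z + card W" using card_Un_Int[OF assms(3,4)] by simp
  finally show ?thesis .
qed

text \<open>Pairs and their reversals cancel; this is the handshake lemma for sets of arcs.\<close>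
lemma even_card_sym_irrefl:
  assumes "finite S" "sym S" "irrefl S"
  shows "even (card S)"
  using assms
proof (induction S rule: finite_psubset_induct)
  case (psubset S)
  show ?case
  proof (cases "S = {}")
    case False
    then obtain x y where xy: "(x, y) \<in> S" by auto
    then have yx: "(y, x) \<in> S" "x \<noteq> y" using psubset.prems by (auto dest: symD simp: irrefl_def)
    let ?S = "S - {(x, y), (y, x)}"
    have "even (card ?S)"
      using xy psubset.prems by (intro psubset.IH) (auto simp: sym_def irrefl_def)
    moreover have "card {(x, y), (y, x)} = 2" using yx by simp
    then have "card ?S = card S - 2" using xy yx by (subst card_Diff_subset) auto
    moreover have "card S \<ge> 2"
      using \<open>card {(x, y), (y, x)} = 2\<close> xy yx psubset.hyps card_mono[of S "{(x, y), (y, x)}"] by auto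
    ultimately show ?thesis by simp
  qed simp
qed

definition aut :: "'a set \<Rightarrow> 'a rel \<Rightarrow> ('a \<Rightarrow> 'a) \<Rightarrow> bool" where
  "aut V R f \<longleftrightarrow> bij_betw f V V \<and> (\<forall>x\<in>V. \<forall>y\<in>V. (f x, f y) \<in> R \<longleftrightarrow> (x, y) \<in> R)"

text \<open>
  Loops are admitted, so that closed neighbourhoods are covered as well, by adding the diagonal
  to the adjacency relation.
\<close>
locale transitive_relation =
  fixes V :: "'a set" and R :: "'a rel"
  assumes finite_V: "finite V" and nonempty_V: "V \<noteq> {}"
    and R_sub: "R \<subseteq> V \<times> V" and sym_R: "sym R"
    and transitive: "x \<in> V \<Longrightarrow> y \<in> V \<Longrightarrow> \<exists>f. aut V R f \<and> f x = y"
begin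

lemma finite_sub: "A \<subseteq> V \<Longrightarrow> finite A"
  using finite_V finite_subset by blast

lemma R_memD: "(x, y) \<in> R \<Longrightarrow> x \<in> V \<and> y \<in> V"
  using R_sub by auto

lemma Image_sub: "R `` A \<subseteq> V"
  using R_sub by auto

lemma aut_inj: "aut V R f \<Longrightarrow> A \<subseteq> V \<Longrightarrow> inj_on f A"
  unfolding aut_def bij_betw_def using inj_on_subset by blast

lemma aut_image_sub: "aut V R f \<Longrightarrow> A \<subseteq> V \<Longrightarrow> f ` A \<subseteq> V"
  unfolding aut_def bij_betw_def by blast

lemma aut_image_Diff:
  assumes "aut V R f" "A \<subseteq> V"
  shows "f ` (V - A) = V - f ` A"
  using assms unfolding aut_def bij_betw_def by (metis Diff_subset inj_on_image_set_diff order_refl)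

lemma aut_card: "aut V R f \<Longrightarrow> A \<subseteq> V \<Longrightarrow> card (f ` A) = card A"
  using aut_inj card_image by blast

lemma aut_Image:
  assumes f: "aut V R f" and A: "A \<subseteq> V"
  shows "R `` (f ` A) = f ` (R `` A)"
proof
  show "R `` (f ` A) \<subseteq> f ` (R `` A)"
  proof
    fix y assume "y \<in> R `` (f ` A)"
    then obtain x where x: "x \<in> A" "(f x, y) \<in> R" by auto
    then obtain z where "z \<in> V" "y = f z"
      using f R_memD unfolding aut_def bij_betw_def by blast
    then show "y \<in> f ` (R `` A)" using x f A unfolding aut_def by blast
  qed
  show "f ` (R `` A) \<subseteq> R `` (f ` A)"
    using f A R_memD unfolding aut_def by blast
qed

lemma regular: "\<exists>k. \<forall>x\<in>V. card (R `` {x}) = k"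
proof -
  obtain x where x: "x \<in> V" using nonempty_V by auto
  have "card (R `` {y}) = card (R `` {x})" if y: "y \<in> V" for y
  proof -
    obtain f where f: "aut V R f" "f x = y" using transitive x y by blast
    have "R `` {y} = f ` (R `` {x})" using aut_Image[OF f(1), of "{x}"] x f(2) by simp
    then show ?thesis using aut_card[OF f(1) Image_sub] by simp
  qed
  then show ?thesis by blast
qed

text \<open>These are the systems of imprimitivity of the automorphism group; transitivity makes them cover \<open>V\<close>.\<close>
definition block_system :: "'a set set \<Rightarrow> bool" where
  "block_system P \<longleftrightarrow> P \<noteq> {} \<and> {} \<notin> P \<and> P \<subseteq> Pow V \<and> pairwise disjnt P \<and>
    (\<forall>A\<in>P. \<forall>f. aut V R f \<longrightarrow> f ` A \<in> P)"

lemma block_systemD: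
  assumes "block_system P"
  shows "P \<noteq> {}" and "A \<in> P \<Longrightarrow> A \<subseteq> V" and "A \<in> P \<Longrightarrow> A \<noteq> {}"
    and "A \<in> P \<Longrightarrow> B \<in> P \<Longrightarrow> x \<in> A \<Longrightarrow> x \<in> B \<Longrightarrow> A = B"
    and "A \<in> P \<Longrightarrow> aut V R f \<Longrightarrow> f ` A \<in> P"
proof -
  have *: "P \<noteq> {}" "{} \<notin> P" "P \<subseteq> Pow V" "pairwise disjnt P"
    "\<forall>A\<in>P. \<forall>f. aut V R f \<longrightarrow> f ` A \<in> P"
    using assms by (simp_all add: block_system_def)
  show "P \<noteq> {}" by (rule *(1))
  show "A \<subseteq> V" if "A \<in> P" using *(3) that by auto
  show "A \<noteq> {}" if "A \<in> P" using *(2) that by metis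
  show "A = B" if "A \<in> P" "B \<in> P" "x \<in> A" "x \<in> B"
    using pairwiseD[OF *(4) that(1,2)] that(3,4) by (auto simp only: disjnt_iff)
  show "f ` A \<in> P" if "A \<in> P" "aut V R f" using *(5) that by simp
qed

lemma block_system_cover:
  assumes "block_system P"
  shows "\<Union>P = V"
proof
  show "\<Union>P \<subseteq> V" using block_systemD(2)[OF assms] by auto
  obtain A where A: "A \<in> P" using block_systemD(1)[OF assms] by auto
  then obtain x where x: "x \<in> A" using block_systemD(3)[OF assms A] by auto
  show "V \<subseteq> \<Union>P"
  proof
    fix y assume "y \<in> V"
    then obtain f where "aut V R f" "f x = y"
      using transitive x block_systemD(2)[OF assms A] by blast
    then show "y \<in> \<Union>P" using block_systemD(5)[OF assms A] x by blast
  qed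
qed

lemma block_system_dvd:
  assumes P: "block_system P" and b: "\<And>A. A \<in> P \<Longrightarrow> card A = b"
    and U: "U \<subseteq> V" "\<And>A. A \<in> P \<Longrightarrow> A \<subseteq> U \<or> A \<inter> U = {}"
  shows "b dvd card U"
proof -
  have "U = \<Union>{A \<in> P. A \<subseteq> U}"
  proof
    show "U \<subseteq> \<Union>{A \<in> P. A \<subseteq> U}"
    proof
      fix x assume x: "x \<in> U"
      then obtain A where "A \<in> P" "x \<in> A" using block_system_cover[OF P] U(1) by blast
      then show "x \<in> \<Union>{A \<in> P. A \<subseteq> U}" using U(2)[of A] x by auto
    qed
  qed auto
  moreover have "b dvd card (\<Union>{A \<in> P. A \<subseteq> U})"
  proof (rule dvd_partition)
    show "finite (\<Union>{A \<in> P. A \<subseteq> U})" using \<open>U = _\<close> finite_sub[OF U(1)] by simp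
    show "\<forall>A\<in>{A \<in> P. A \<subseteq> U}. b dvd card A" using b by auto
    show "\<forall>A\<in>{A \<in> P. A \<subseteq> U}. \<forall>B\<in>{A \<in> P. A \<subseteq> U}. A \<noteq> B \<longrightarrow> A \<inter> B = {}"
      using block_systemD(4)[OF P] by blast
  qed
  ultimately show ?thesis by metis
qed

text \<open>An automorphism that takes one member of a block to another one preserves the block.\<close>
lemma block_regular:
  assumes P: "block_system P" and A: "A \<in> P"
  shows "\<exists>r. \<forall>x\<in>A. card (R `` {x} \<inter> A) = r"
proof -
  have AV: "A \<subseteq> V" using block_systemD(2)[OF P A] .
  obtain x where x: "x \<in> A" using block_systemD(3)[OF P A] by auto
  have "card (R `` {y} \<inter> A) = card (R `` {x} \<inter> A)" if y: "y \<in> A" for y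
  proof -
    obtain f where f: "aut V R f" "f x = y" using transitive x y AV by blast
    have "f ` A \<in> P" using block_systemD(5)[OF P A f(1)] .
    moreover have "y \<in> f ` A" using f x by auto
    ultimately have fA: "f ` A = A" using block_systemD(4)[OF P _ A] y by blast
    have "f ` (R `` {x} \<inter> A) = f ` (R `` {x}) \<inter> f ` A"
      using aut_inj[OF f(1) order_refl] AV Image_sub by (intro inj_on_image_Int) auto
    also have "\<dots> = R `` {y} \<inter> A"
      using aut_Image[OF f(1), of "{x}"] f(2) x AV fA by auto
    finally have "R `` {y} \<inter> A = f ` (R `` {x} \<inter> A)" by simp
    then show ?thesis using aut_card[OF f(1), of "R `` {x} \<inter> A"] AV by auto
  qed
  then show ?thesis by blast
qed

text \<open>
  Among the sets with smallest excess \<open>|R(Y)| - |Y|\<close> those of smallest size are blocks. The map that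
  takes \<open>Y\<close> to the complement of \<open>R(Y)\<close> does not increase the excess, so it maps minimizers to
  minimizers. This serves twice: it shows that two small minimizers that meet leave enough room
  for the submodularity argument, and it shows that \<open>R(Y)\<close> is a union of blocks, so that the excess
  is divisible by the size of the blocks.
\<close>
lemma expansion_atoms:
  assumes Y0: "Y0 \<subseteq> V" "Y0 \<noteq> {}" "R `` Y0 \<noteq> V"
  obtains P b where "block_system P"
    and "\<And>Y. Y \<in> P \<Longrightarrow> card Y = b \<and> R `` Y \<noteq> V \<and> card (R `` Y) + card Y0 \<le> card (R `` Y0) + b"
    and "\<And>Y Z. Y \<in> P \<Longrightarrow> Z \<in> P \<Longrightarrow> Z \<subseteq> R `` Y \<or> Z \<inter> R `` Y = {}"
proof -
  let ?F = "\<lambda>Y. Y \<subseteq> V \<and> Y \<noteq> {} \<and> R `` Y \<noteq> V"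
  \<comment> \<open>The excess, shifted by \<open>card V\<close> to make it a natural number.\<close>
  define g where "g Y = card (R `` Y) + card (V - Y)" for Y
  have "\<exists>Y. ?F Y \<and> (\<forall>Z. ?F Z \<longrightarrow> g Y \<le> g Z)"
    by (rule ex_has_least_nat[of _ Y0]) (use Y0 in auto)
  then obtain Y1 where Y1: "?F Y1 \<and> (\<forall>Z. ?F Z \<longrightarrow> g Y1 \<le> g Z)" ..
  note Y1F = Y1[THEN conjunct1] and Y1min = Y1[THEN conjunct2, THEN spec, THEN mp]
  let ?M = "\<lambda>Y. ?F Y \<and> g Y = g Y1"
  have "\<exists>Y. ?M Y \<and> (\<forall>Z. ?M Z \<longrightarrow> card Y \<le> card Z)"
    by (rule ex_has_least_nat[of _ Y1]) (use Y1F in auto)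
  then obtain Y2 where Y2: "?M Y2 \<and> (\<forall>Z. ?M Z \<longrightarrow> card Y2 \<le> card Z)" ..
  note Y2M = Y2[THEN conjunct1] and Y2min = Y2[THEN conjunct2, THEN spec, THEN mp]
  define P where "P = {Y. ?M Y \<and> card Y = card Y2}"
  have Y2P: "Y2 \<in> P" using Y2M unfolding P_def by simp
  have dual: "?M (V - R `` W)" if W: "?M W" for W
  proof -
    have sub: "R `` (V - R `` W) \<subseteq> V - W"
      using sym_R R_memD by (auto dest: symD)
    have F: "?F (V - R `` W)" using W sub Image_sub by blast
    have "V - (V - R `` W) = R `` W" using Image_sub by auto
    then have "g (V - R `` W) \<le> g W"
      unfolding g_def using card_mono[OF _ sub] finite_V by simp
    then show ?thesis using F W Y1min[OF F] by simp
  qed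
  \<comment> \<open>The union can have full image and then is no competitor; the size of the complement of \<open>R `` W\<close>
    ensures that its value is at least the minimum all the same.\<close>
  have key: "Z \<subseteq> W \<or> Z \<inter> W = {}" if W: "?M W" and Z: "Z \<in> P" for W Z
  proof (rule disjCI)
    assume "Z \<inter> W \<noteq> {}"
    have ZM: "?M Z" "card Z = card Y2" using Z unfolding P_def by auto
    have fin: "finite W" "finite Z" using W ZM finite_sub by auto
    have finR: "finite (R `` A)" for A using finite_sub Image_sub by blast
    have "card Y2 \<le> card (V - R `` W)" using Y2min[OF dual[OF W]] .
    then have big: "card (R `` W) + card Z \<le> card V"
      using ZM(2) card_Diff_subset[OF finR Image_sub, of W] card_mono[OF finite_V Image_sub, of W]
      by simp
    have "g Y1 \<le> g (W \<union> Z)"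
    proof (cases "R `` (W \<union> Z) = V")
      case True
      have "card (W \<union> Z) + card (W \<inter> Z) = card W + card Z" using card_Un_Int[OF fin] by simp
      moreover have "card (V - (W \<union> Z)) = card V - card (W \<union> Z)" "card (V - W) = card V - card W"
        "card (W \<union> Z) \<le> card V" "card W \<le> card V"
        using W ZM fin finite_V by (auto intro!: card_Diff_subset card_mono)
      ultimately have "g W \<le> g (W \<union> Z)"
        unfolding g_def True using big by linarith
      then show ?thesis using W by simp
    next
      case False then show ?thesis using W ZM by (intro Y1min) auto
    qed
    moreover have "g (W \<inter> Z) + g (W \<union> Z) \<le> g W + g Z"
    proof -
      have "card (R `` (W \<inter> Z)) + card (R `` (W \<union> Z)) \<le> card (R `` W) + card (R `` Z)"
        by (rule card_add_mono) (use finR in auto)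
      moreover have "card (V - (W \<inter> Z)) + card (V - (W \<union> Z)) \<le> card (V - W) + card (V - Z)"
        by (rule card_add_mono) (use finite_V in auto)
      ultimately show ?thesis unfolding g_def by linarith
    qed
    ultimately have le: "g (W \<inter> Z) \<le> g Y1" using W ZM by linarith
    have F: "?F (W \<inter> Z)"
    proof -
      have "R `` (W \<inter> Z) \<subseteq> R `` W" by auto
      then show ?thesis using W \<open>Z \<inter> W \<noteq> {}\<close> Image_sub[of W] by blast
    qed
    then have "?M (W \<inter> Z)" using le Y1min[OF F] by simp
    then have "card Z \<le> card (W \<inter> Z)" using Y2min ZM(2) by simp
    then have "W \<inter> Z = Z" using fin by (intro card_seteq) auto
    then show "Z \<subseteq> W" by auto
  qed
  have MP: "?M Y" if "Y \<in> P" for Y using that unfolding P_def by simp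
  have bs: "block_system P"
    unfolding block_system_def
  proof (intro conjI ballI allI impI)
    show "P \<noteq> {}" using Y2P by auto
    show "{} \<notin> P" unfolding P_def by auto
    show "P \<subseteq> Pow V" unfolding P_def by auto
    show "pairwise disjnt P"
    proof (rule pairwiseI)
      fix Y Z assume "Y \<in> P" "Z \<in> P" "Y \<noteq> Z"
      then show "disjnt Y Z"
        using key[OF MP, of Y Z] key[OF MP, of Z Y] unfolding disjnt_def by auto
    qed
    fix A f assume A: "A \<in> P" and f: "aut V R f"
    have AV: "A \<subseteq> V" using A unfolding P_def by auto
    have im: "R `` (f ` A) = f ` (R `` A)" by (rule aut_Image[OF f AV])
    have c1: "card (R `` (f ` A)) = card (R `` A)" unfolding im by (rule aut_card[OF f Image_sub])
    have "card (V - f ` A) = card (V - A)"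
      using aut_card[OF f, of "V - A"] aut_image_Diff[OF f AV] by auto
    then have "g (f ` A) = g A" unfolding g_def c1 by simp
    moreover have "R `` (f ` A) \<noteq> V"
    proof
      assume "R `` (f ` A) = V"
      then have "R `` A = V" using c1 card_subset_eq[OF finite_V Image_sub, of A] by simp
      then show False using A unfolding P_def by simp
    qed
    ultimately show "f ` A \<in> P"
      using A aut_card[OF f AV] aut_image_sub[OF f AV] unfolding P_def by auto
  qed
  show ?thesis
  proof (rule that[OF bs, of "card Y2"])
    fix Y assume Y: "Y \<in> P"
    have YM: "?M Y" "card Y = card Y2" using Y unfolding P_def by auto
    have "g Y \<le> g Y0" using YM(1) Y1min[of Y0] Y0 by simp
    moreover have "card (V - Y) = card V - card Y" "card (V - Y0) = card V - card Y0"
      "card Y \<le> card V" "card Y0 \<le> card V"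
      using YM(1) Y0(1) finite_V finite_sub by (auto intro!: card_Diff_subset card_mono)
    ultimately have "card (R `` Y) + card Y0 \<le> card (R `` Y0) + card Y2"
      using YM(2) unfolding g_def by linarith
    then show "card Y = card Y2 \<and> R `` Y \<noteq> V \<and> card (R `` Y) + card Y0 \<le> card (R `` Y0) + card Y2"
      using YM by simp
  next
    fix Y Z assume "Y \<in> P" "Z \<in> P"
    then have "Z \<subseteq> V - R `` Y \<or> Z \<inter> (V - R `` Y) = {}" "Z \<subseteq> V"
      using key[OF dual[OF MP]] unfolding P_def by auto
    then show "Z \<subseteq> R `` Y \<or> Z \<inter> R `` Y = {}" by auto
  qed
qed

end

section \<open>Small edge cuts\<close>

text \<open>
  Connectedness is stated by closed sets, which is the form in which it is applied throughout.
\<close>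
locale odd_transitive_graph = transitive_relation V E
  for V :: "'a set" and E :: "'a rel" +
  fixes k :: nat
  assumes irrefl_E: "irrefl E"
    and connected: "A \<subseteq> V \<Longrightarrow> A \<noteq> {} \<Longrightarrow> E `` A \<subseteq> A \<Longrightarrow> A = V"
    and odd_order: "odd (card V)"
    and degree: "x \<in> V \<Longrightarrow> card (E `` {x}) = k"
begin

text \<open>Ordered pairs are counted, so \<open>links A A\<close> is twice the number of edges inside \<open>A\<close>.\<close>
definition links :: "'a set \<Rightarrow> 'a set \<Rightarrow> nat" where
  "links A B = card (E \<inter> A \<times> B)"

definition edge_cut :: "'a set \<Rightarrow> nat" where
  "edge_cut A = links A (V - A)"

lemma finite_E: "finite E"
  using R_sub finite_V finite_subset by blast

lemma links_sum:
  assumes "A \<subseteq> V"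
  shows "links A B = (\<Sum>x\<in>A. card (E `` {x} \<inter> B))"
proof -
  have "E \<inter> A \<times> B = Sigma A (\<lambda>x. E `` {x} \<inter> B)" by auto
  moreover have "finite (E `` {x})" for x using finite_sub[OF Image_sub] .
  ultimately show ?thesis
    unfolding links_def using finite_sub[OF assms] by (simp add: card_SigmaI)
qed

lemma links_all:
  assumes "A \<subseteq> V"
  shows "links A V = k * card A"
proof -
  have "card (E `` {x} \<inter> V) = k" if "x \<in> A" for x
    using degree[of x] that assms Int_absorb2[OF Image_sub[of "{x}"]] by auto
  then show ?thesis using links_sum[OF assms, of V] by simp
qed

lemma links_mono: "A \<subseteq> A' \<Longrightarrow> B \<subseteq> B' \<Longrightarrow> links A B \<le> links A' B'"
  unfolding links_def using finite_E by (intro card_mono) auto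

lemma links_commute: "links A B = links B A"
proof -
  have "E \<inter> B \<times> A = (\<lambda>(x, y). (y, x)) ` (E \<inter> A \<times> B)"
    using sym_R by (auto simp: sym_def image_iff)
  moreover have "inj_on (\<lambda>(x, y). (y, x)) (E \<inter> A \<times> B)" by (auto simp: inj_on_def)
  ultimately show ?thesis unfolding links_def by (simp add: card_image)
qed

lemma links_Un_right:
  assumes "B \<inter> C = {}"
  shows "links A (B \<union> C) = links A B + links A C"
proof -
  have "E \<inter> A \<times> (B \<union> C) = (E \<inter> A \<times> B) \<union> (E \<inter> A \<times> C)" by auto
  then show ?thesis unfolding links_def using assms finite_E
    by (simp add: card_Un_disjoint Int_Un_distrib disjoint_iff)
qed

lemma cut_plus_links:
  assumes "A \<subseteq> V"
  shows "edge_cut A + links A A = k * card A"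
proof -
  have "(V - A) \<inter> A = {}" "(V - A) \<union> A = V" using assms by auto
  then show ?thesis using links_Un_right[of "V - A" A A] links_all[OF assms] unfolding edge_cut_def by simp
qed

lemma cut_compl: "A \<subseteq> V \<Longrightarrow> edge_cut (V - A) = edge_cut A"
  unfolding edge_cut_def by (simp add: links_commute double_diff)

lemma even_links: "even (links A A)"
  unfolding links_def using finite_E sym_R irrefl_E
  by (intro even_card_sym_irrefl) (auto simp: sym_def irrefl_def)

lemma even_degree: "even k"
  using even_links[of V] links_all[of V] odd_order by simp

lemma card_nbrs_inside_le:
  assumes "A \<subseteq> V" "x \<in> A"
  shows "card (E `` {x} \<inter> A) \<le> card A - 1"
proof -
  have "E `` {x} \<inter> A \<subseteq> A - {x}" using irrefl_E by (auto simp: irrefl_def)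
  then have "card (E `` {x} \<inter> A) \<le> card (A - {x})"
    using finite_sub[OF assms(1)] by (intro card_mono) auto
  then show ?thesis using assms finite_sub by simp
qed

lemma links_inside_le:
  assumes "A \<subseteq> V"
  shows "links A A \<le> card A * (card A - 1)"
  unfolding links_sum[OF assms]
  using sum_bounded_above[of A "\<lambda>x. card (E `` {x} \<inter> A)" "card A - 1"]
    card_nbrs_inside_le[OF assms] by simp

lemma cut_submodular:
  shows "edge_cut (A \<inter> B) + edge_cut (A \<union> B) \<le> edge_cut A + edge_cut B"
  unfolding edge_cut_def links_def by (rule card_add_mono) (use finite_E in auto)

text \<open>This is submodularity for \<open>A\<close> and the complement of \<open>B\<close>, since a set and its complement have the same cut.\<close>
lemma cut_posimodular:
  assumes "A \<subseteq> V" "B \<subseteq> V"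
  shows "edge_cut (A - B) + edge_cut (B - A) \<le> edge_cut A + edge_cut B"
proof -
  have "A \<inter> (V - B) = A - B" "A \<union> (V - B) = V - (B - A)" "B - A \<subseteq> V" using assms by auto
  then show ?thesis
    using cut_submodular[of A "V - B"] cut_compl[of B] cut_compl[of "B - A"] assms by auto
qed

lemma cut_aut:
  assumes f: "aut V E f" and A: "A \<subseteq> V"
  shows "edge_cut (f ` A) = edge_cut A"
proof -
  have edge: "(f x, f y) \<in> E \<longleftrightarrow> (x, y) \<in> E" if "x \<in> A" "y \<in> V - A" for x y
    using f A that unfolding aut_def by auto
  have "E \<inter> (f ` A) \<times> (f ` (V - A)) = map_prod f f ` (E \<inter> A \<times> (V - A))"
  proof (intro equalityI subsetI)
    fix p assume "p \<in> E \<inter> (f ` A) \<times> (f ` (V - A))"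
    then obtain x y where "p = (f x, f y)" "x \<in> A" "y \<in> V - A" "(f x, f y) \<in> E" by auto
    then have "p = map_prod f f (x, y)" "(x, y) \<in> E \<inter> A \<times> (V - A)" using edge by auto
    then show "p \<in> map_prod f f ` (E \<inter> A \<times> (V - A))" by (rule image_eqI)
  qed (use edge in auto)
  then have "E \<inter> (f ` A) \<times> (V - f ` A) = map_prod f f ` (E \<inter> A \<times> (V - A))"
    unfolding aut_image_Diff[OF f A] .
  moreover have "inj_on (map_prod f f) (E \<inter> A \<times> (V - A))"
    by (rule inj_on_subset[OF map_prod_inj_on[OF aut_inj[OF f order_refl] aut_inj[OF f order_refl]]])
      (use A in auto)
  ultimately show ?thesis unfolding edge_cut_def links_def by (simp add: card_image)
qed

lemma cut_pos:
  assumes "A \<subseteq> V" "A \<noteq> {}" "A \<noteq> V"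
  shows "0 < edge_cut A"
proof -
  obtain x y where "x \<in> A" "(x, y) \<in> E" "y \<notin> A" using connected[OF assms(1,2)] assms(3) by blast
  then have "(x, y) \<in> E \<inter> A \<times> (V - A)" using R_memD by auto
  then show ?thesis unfolding edge_cut_def links_def using finite_E by (auto simp: card_gt_0_iff)
qed

text \<open>
  Among the sets with the smallest cut, subject to the size bounds, take one of smallest size; it has
  at most half of the vertices. If two sets of this kind meet and have more than \<open>2q - 2\<close> vertices,
  then their intersection or their difference has at least \<open>q\<close> vertices and is a smaller competitor,
  by submodularity or posimodularity. If no two of them meet, they form a system of blocks.
\<close>
lemma cut_atom:
  assumes A0: "A0 \<subseteq> V" "q \<le> card A0" "card A0 + q \<le> card V" and q: "1 \<le> q"
  obtains A where "A \<subseteq> V" "q \<le> card A" "card A + q \<le> card V" "edge_cut A \<le> edge_cut A0"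
    "card A + 2 \<le> 2 * q \<or> card A dvd card V \<and> (\<exists>r. \<forall>x\<in>A. card (E `` {x} \<inter> A) = r)"
proof -
  let ?F = "\<lambda>A. A \<subseteq> V \<and> q \<le> card A \<and> card A + q \<le> card V"
  have "\<exists>A. ?F A \<and> (\<forall>B. ?F B \<longrightarrow> edge_cut A \<le> edge_cut B)"
    by (rule ex_has_least_nat[of _ A0]) (use A0 in auto)
  then obtain A1 where A1: "?F A1 \<and> (\<forall>B. ?F B \<longrightarrow> edge_cut A1 \<le> edge_cut B)" ..
  note A1F = A1[THEN conjunct1] and A1min = A1[THEN conjunct2, THEN spec, THEN mp]
  let ?M = "\<lambda>A. ?F A \<and> edge_cut A = edge_cut A1"
  have "\<exists>A. ?M A \<and> (\<forall>B. ?M B \<longrightarrow> card A \<le> card B)"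
    by (rule ex_has_least_nat[of _ A1]) (use A1F in auto)
  then obtain A2 where A2: "?M A2 \<and> (\<forall>B. ?M B \<longrightarrow> card A2 \<le> card B)" ..
  note A2M = A2[THEN conjunct1] and A2min = A2[THEN conjunct2, THEN spec, THEN mp]
  define P where "P = {A. ?M A \<and> card A = card A2}"
  have A2P: "A2 \<in> P" using A2M unfolding P_def by simp
  have half: "2 * card A2 \<le> card V"
  proof -
    have c: "card (V - A2) = card V - card A2"
      using A2M finite_sub by (intro card_Diff_subset) auto
    then have "?M (V - A2)" using A2M cut_compl[of A2] by auto
    from A2min[OF this] show ?thesis using c A2M by linarith
  qed
  have low: "edge_cut A1 < edge_cut B" if "?F B" "card B < card A2" for B
    using A1min[OF that(1)] A2min[of B] that by (metis le_neq_implies_less not_less)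
  have small: "card A2 + 2 \<le> 2 * q" if A: "A \<in> P" and B: "B \<in> P" and "A \<noteq> B" "A \<inter> B \<noteq> {}" for A B
  proof (rule ccontr)
    assume big: "\<not> card A2 + 2 \<le> 2 * q"
    have AB: "?M A" "?M B" "card A = card A2" "card B = card A2" using A B unfolding P_def by auto
    have fin: "finite A" "finite B" using AB finite_sub by auto
    have inter: "card (A \<inter> B) < card A2"
    proof -
      have "A \<inter> B \<subset> A \<or> A \<inter> B \<subset> B" using \<open>A \<noteq> B\<close> by auto
      then show ?thesis using psubset_card_mono[OF fin(1)] psubset_card_mono[OF fin(2)] AB by metis
    qed
    have un: "card (A \<union> B) + card (A \<inter> B) = 2 * card A2" using card_Un_Int[OF fin] AB by simp
    have dA: "card (A - B) + card (A \<inter> B) = card A2" "card (B - A) + card (A \<inter> B) = card A2"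
      using card_Diff_subset_Int[of A B] card_Diff_subset_Int[of B A] fin AB inter
      by (simp_all add: Int_commute)
    have pos: "0 < card (A \<inter> B)" using \<open>A \<inter> B \<noteq> {}\<close> fin by (simp add: card_gt_0_iff)
    consider "q \<le> card (A \<inter> B)" | "q \<le> card (A - B)" using dA big by linarith
    then show False
    proof cases
      case 1
      have "?F (A \<inter> B)" using AB 1 inter by auto
      moreover have "?F (A \<union> B)" using AB 1 un half inter by auto
      ultimately show False
        using low[OF _ inter] A1min[of "A \<union> B"] cut_submodular[of A B] AB(1,2) by simp
    next
      case 2
      have F: "?F (A - B)" "?F (B - A)" using AB 2 dA half pos by auto
      have "edge_cut A1 < edge_cut (A - B)" by (rule low[OF F(1)]) (use dA pos in auto)
      moreover have "edge_cut A1 < edge_cut (B - A)" by (rule low[OF F(2)]) (use dA pos in auto)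
      ultimately show False using cut_posimodular[of A B] AB(1,2) by simp
    qed
  qed
  have "card A2 + 2 \<le> 2 * q \<or> card A2 dvd card V \<and> (\<exists>r. \<forall>x\<in>A2. card (E `` {x} \<inter> A2) = r)"
  proof (rule disjCI)
    assume n: "\<not> (card A2 dvd card V \<and> (\<exists>r. \<forall>x\<in>A2. card (E `` {x} \<inter> A2) = r))"
    show "card A2 + 2 \<le> 2 * q"
    proof (rule ccontr)
      assume big: "\<not> ?thesis"
      have "block_system P"
        unfolding block_system_def
      proof (intro conjI ballI allI impI)
        show "P \<noteq> {}" using A2P by auto
        show "{} \<notin> P" using q unfolding P_def by auto
        show "P \<subseteq> Pow V" unfolding P_def by auto
        show "pairwise disjnt P"
          by (rule pairwiseI) (use small big in \<open>auto simp: disjnt_def\<close>)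
        fix A f assume A: "A \<in> P" and f: "aut V E f"
        then have "A \<subseteq> V" unfolding P_def by auto
        then show "f ` A \<in> P"
          using A cut_aut[OF f] aut_card[OF f] aut_image_sub[OF f] unfolding P_def by simp
      qed
      note bs = this
      have "card A2 dvd card V"
        by (rule block_system_dvd[OF bs]) (auto simp: P_def)
      then show False using n block_regular[OF bs A2P] by simp
    qed
  qed
  moreover have "edge_cut A2 \<le> edge_cut A0" using A2M A1min[of A0] A0 by simp
  ultimately show ?thesis using that[of A2] A2M by simp
qed

text \<open>
  The size of \<open>A\<close> is odd, as a divisor of the order, so the degree \<open>r\<close> inside \<open>A\<close> is even. As \<open>k\<close> is even
  too and connectedness gives \<open>r \<noteq> k\<close>, each vertex of \<open>A\<close> has at least two neighbours outside.
\<close>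
lemma regular_part:
  assumes A: "A \<subseteq> V" "A \<noteq> {}" "A \<noteq> V"
    and dvd: "card A dvd card V" and r: "\<And>x. x \<in> A \<Longrightarrow> card (E `` {x} \<inter> A) = r"
  shows "odd (card A)" and "r + 2 \<le> k" and "r < card A" and "edge_cut A = card A * (k - r)"
proof -
  show odd: "odd (card A)" using dvd odd_order by (meson dvd_trans)
  have l: "links A A = card A * r" using links_sum[OF A(1), of A] r by simp
  then have "even r" using even_links[of A] odd by simp
  have c: "edge_cut A + card A * r = card A * k"
    using cut_plus_links[OF A(1)] l by (simp add: mult.commute)
  then have "card A * r < card A * k" using cut_pos[OF A] by linarith
  then have "r < k" by simp
  then show "r + 2 \<le> k" using \<open>even r\<close> even_degree by presburger
  show "edge_cut A = card A * (k - r)" using c by (simp add: diff_mult_distrib2)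
  obtain x where "x \<in> A" using A by auto
  then show "r < card A"
    using card_nbrs_inside_le[OF A(1), of x] r[of x] finite_sub[OF A(1)] A(2)
    by (metis Suc_pred' card_gt_0_iff le_imp_less_Suc)
qed

text \<open>
  By \<open>cut_atom\<close> with \<open>q = 2\<close> only sets with two vertices and blocks need to be considered. An edge
  has cut \<open>2k - 2\<close>, hence no better lower bound holds.
\<close>
lemma cut_ge:
  assumes A0: "A0 \<subseteq> V" "2 \<le> card A0" "card A0 + 2 \<le> card V" and k: "2 \<le> k"
  shows "2 * k \<le> edge_cut A0 + 2"
proof -
  obtain A where A: "A \<subseteq> V" "2 \<le> card A" "card A + 2 \<le> card V" "edge_cut A \<le> edge_cut A0"
    "card A + 2 \<le> 2 * 2 \<or> card A dvd card V \<and> (\<exists>r. \<forall>x\<in>A. card (E `` {x} \<inter> A) = r)"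
    using cut_atom[OF A0] by auto
  have "2 * k \<le> edge_cut A + 2"
  proof (cases "card A + 2 \<le> 2 * 2")
    case True
    then have "card A = 2" using A(2) by simp
    then show ?thesis using cut_plus_links[OF A(1)] links_inside_le[OF A(1)] by simp
  next
    case False
    then obtain r where dvd: "card A dvd card V" and r: "\<And>x. x \<in> A \<Longrightarrow> card (E `` {x} \<inter> A) = r"
      using A(5) by blast
    have ne: "A \<noteq> {}" "A \<noteq> V" using A by auto
    note rp = regular_part[OF A(1) ne dvd r]
    show ?thesis
    proof (cases "k \<le> card A + 1")
      case True
      have "card A * 2 \<le> card A * (k - r)" using rp(2) by (intro mult_left_mono) auto
      then show ?thesis using True rp(4) by linarith
    next
      case False
      \<comment> \<open>Substituting nonnegative slacks turns the quadratic estimate into one between coefficients.\<close>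
      define a where "a = card A - 2"
      define j where "j = k - card A - 2"
      have aj: "card A = a + 2" "k = a + j + 4" using A(2) False unfolding a_def j_def by auto
      have "(a + 2) * (j + 3) \<le> card A * (k - r)"
        using rp(3) aj by (intro mult_mono) auto
      then have "(a + 2) * (j + 3) \<le> edge_cut A" using rp(4) by simp
      then show ?thesis unfolding aj by (simp add: algebra_simps)
    qed
  qed
  then show ?thesis using A(4) by linarith
qed

text \<open>
  By \<open>cut_atom\<close> with \<open>q = 3\<close> there is a set with cut at most six that is a block or has at most four
  vertices. A block with more than four vertices has a cut of at least ten. A set of three
  vertices with cut at most six is a triangle, and one of four vertices lacks at most one edge.
\<close>
lemma ex_triangle:
  assumes A0: "A0 \<subseteq> V" "3 \<le> card A0" "card A0 + 3 \<le> card V" and few: "edge_cut A0 \<le> 6" and k: "k = 4"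
  shows "\<exists>x y z. (x, y) \<in> E \<and> (y, z) \<in> E \<and> (x, z) \<in> E"
proof -
  obtain A where A: "A \<subseteq> V" "3 \<le> card A" "card A + 3 \<le> card V" "edge_cut A \<le> edge_cut A0"
    "card A + 2 \<le> 2 * 3 \<or> card A dvd card V \<and> (\<exists>r. \<forall>x\<in>A. card (E `` {x} \<inter> A) = r)"
    using cut_atom[OF A0] by auto
  have small: "card A \<le> 4"
  proof (rule ccontr)
    assume "\<not> card A \<le> 4"
    then obtain r where dvd: "card A dvd card V" and r: "\<And>x. x \<in> A \<Longrightarrow> card (E `` {x} \<inter> A) = r"
      using A(5) by auto
    have ne: "A \<noteq> {}" "A \<noteq> V" using A by auto
    note rp = regular_part[OF A(1) ne dvd r]
    have "card A * 2 \<le> card A * (k - r)" using rp(2) by (intro mult_left_mono) auto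
    then show False using rp(4) A(4) few \<open>\<not> card A \<le> 4\<close> by linarith
  qed
  have finA: "finite A" by (rule finite_sub[OF A(1)])
  define K where "K = {(x, y). x \<in> A \<and> y \<in> A \<and> x \<noteq> y \<and> (x, y) \<notin> E}"
  have Kfin: "finite K" by (rule finite_subset[of _ "A \<times> A"]) (auto simp: K_def finA)
  have "card (A \<times> A) = card (Id_on A) + links A A + card K"
  proof -
    have "A \<times> A = (Id_on A \<union> (E \<inter> A \<times> A)) \<union> K" unfolding K_def by auto
    also have "card \<dots> = card (Id_on A \<union> (E \<inter> A \<times> A)) + card K"
      by (rule card_Un_disjoint) (auto simp: K_def Id_on_def finA finite_E Kfin[unfolded K_def])
    also have "card (Id_on A \<union> (E \<inter> A \<times> A)) = card (Id_on A) + links A A"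
      unfolding links_def
      by (rule card_Un_disjoint) (use irrefl_E finA finite_E in \<open>auto simp: Id_on_def irrefl_def\<close>)
    finally show ?thesis .
  qed
  moreover have "card (Id_on A) = card A"
  proof -
    have "Id_on A = (\<lambda>x. (x, x)) ` A" by auto
    then show ?thesis by (simp add: card_image inj_on_def)
  qed
  ultimately have sum: "card A * card A = card A + links A A + card K" by (simp add: card_cartesian_product)
  have l: "4 * card A \<le> 6 + links A A"
    using cut_plus_links[OF A(1)] A(4) few unfolding k by linarith
  consider "card A = 3" | "card A = 4" using A(2) small by linarith
  then have "\<exists>B\<subseteq>A. card B = 3 \<and> (\<forall>x\<in>B. \<forall>y\<in>B. x \<noteq> y \<longrightarrow> (x, y) \<in> E)"
  proof cases
    case 1
    then have "card K = 0" using sum l by simp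
    then have "K = {}" using Kfin by simp
    then show ?thesis using 1 unfolding K_def by (intro exI[of _ A]) auto
  next
    case 2
    then have cK: "card K \<le> 2" using sum l by auto
    show ?thesis
    proof (cases "K = {}")
      case True
      obtain x where x: "x \<in> A" using 2 by fastforce
      have "card (A - {x}) = 3" using x 2 finA by simp
      then show ?thesis using True unfolding K_def by (intro exI[of _ "A - {x}"]) auto
    next
      case False
      then obtain x y where xy: "(x, y) \<in> K" by auto
      then have yx: "(y, x) \<in> K" "x \<noteq> y" "x \<in> A" using sym_R unfolding K_def by (auto dest: symD)
      then have "card {(x, y), (y, x)} = 2" by simp
      then have "K = {(x, y), (y, x)}"
        using cK xy yx Kfin by (metis card_seteq empty_subsetI insert_subset)
      then have "\<forall>u\<in>A - {x}. \<forall>v\<in>A - {x}. u \<noteq> v \<longrightarrow> (u, v) \<in> E" unfolding K_def by blast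
      moreover have "card (A - {x}) = 3" using yx 2 finA by simp
      ultimately show ?thesis by (intro exI[of _ "A - {x}"]) auto
    qed
  qed
  then obtain B where B: "card B = 3" "\<forall>x\<in>B. \<forall>y\<in>B. x \<noteq> y \<longrightarrow> (x, y) \<in> E" by blast
  then obtain x y z where "B = {x, y, z}" "x \<noteq> y" "y \<noteq> z" "x \<noteq> z" by (auto simp: card_3_iff)
  then show ?thesis using B by blast
qed

section \<open>Vertex expansion and the deletion of three vertices\<close>

text \<open>
  In a regular graph the edges at \<open>Y\<close> need at least \<open>|Y|\<close> other ends. With equality, \<open>N(N(Y))\<close> lies in
  \<open>Y\<close>, so \<open>Y\<close> and \<open>N(Y)\<close> are the two sides of a bipartition into sets of equal size, contrary to the
  odd order, or they intersect and \<open>N(Y)\<close> is everything.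
\<close>
lemma card_nbrs_gt:
  assumes Y: "Y \<subseteq> V" "Y \<noteq> {}" "E `` Y \<noteq> V" and k: "0 < k"
  shows "card Y < card (E `` Y)"
proof (rule ccontr)
  assume "\<not> ?thesis"
  then have le: "card (E `` Y) \<le> card Y" by simp
  let ?N = "E `` Y"
  have NV: "?N \<subseteq> V" by (rule Image_sub)
  have "E \<inter> Y \<times> V = E \<inter> Y \<times> ?N" using R_memD by auto
  then have 1: "links Y ?N = k * card Y" using links_all[OF Y(1)] unfolding links_def by simp
  have "(V - Y) \<union> Y = V" "(V - Y) \<inter> Y = {}" using Y(1) by auto
  then have 2: "links ?N (V - Y) + links ?N Y = k * card ?N"
    using links_Un_right[of "V - Y" Y ?N] links_all[OF NV] by simp
  have "k * card ?N \<le> k * card Y" using le by simp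
  then have none: "links ?N (V - Y) = 0" and eq: "k * card ?N = k * card Y"
    using 1 2 links_commute[of Y ?N] by linarith+
  have "E \<inter> ?N \<times> (V - Y) = {}" using none finite_E unfolding links_def by simp
  then have closed: "E `` ?N \<subseteq> Y" using R_memD by blast
  have inter: "Y \<inter> ?N = {}"
  proof (rule ccontr)
    assume "Y \<inter> ?N \<noteq> {}"
    then have "Y \<inter> ?N = V" using Y(1) closed by (intro connected) auto
    then show False using Y(3) NV by auto
  qed
  have "E `` (Y \<union> ?N) \<subseteq> Y \<union> ?N" unfolding Image_Un using closed by blast
  then have "Y \<union> ?N = V" using Y(1,2) NV by (intro connected) blast+
  then have "card V = card Y + card ?N"
    using card_Un_disjoint[of Y ?N] inter finite_sub[OF Y(1)] finite_sub[OF NV] by metis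
  then show False using eq k odd_order by simp
qed

text \<open>
  An excess of one or two would be divisible by the odd size of the blocks of \<open>expansion_atoms\<close>. Then the
  blocks are single vertices, with excess \<open>k - 1\<close>, which is at least three.
\<close>
lemma card_nbrs_ge:
  assumes Y0: "Y0 \<subseteq> V" "Y0 \<noteq> {}" "E `` Y0 \<noteq> V" and k: "4 \<le> k"
  shows "card Y0 + 3 \<le> card (E `` Y0)"
proof (rule ccontr)
  assume "\<not> ?thesis"
  then have low: "card (E `` Y0) \<le> card Y0 + 2" by simp
  obtain P b where P: "block_system P"
    and at: "\<And>Y. Y \<in> P \<Longrightarrow> card Y = b \<and> E `` Y \<noteq> V \<and> card (E `` Y) + card Y0 \<le> card (E `` Y0) + b"
    and un: "\<And>Y Z. Y \<in> P \<Longrightarrow> Z \<in> P \<Longrightarrow> Z \<subseteq> E `` Y \<or> Z \<inter> E `` Y = {}"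
    by (rule expansion_atoms[OF Y0]) blast
  obtain Y where Y: "Y \<in> P" using block_systemD(1)[OF P] by auto
  note YV = block_systemD(2)[OF P Y] and Yne = block_systemD(3)[OF P Y]
  have "b dvd card V" by (rule block_system_dvd[OF P]) (use at block_systemD(2)[OF P] in auto)
  then have "odd b" using odd_order by (meson dvd_trans)
  have "b dvd card (E `` Y)" by (rule block_system_dvd[OF P _ Image_sub un[OF Y]]) (use at in auto)
  moreover have gt: "b < card (E `` Y)" using card_nbrs_gt[OF YV Yne] at[OF Y] k by auto
  ultimately have "b dvd card (E `` Y) - b" by simp
  then have "b \<le> card (E `` Y) - b" by (rule dvd_imp_le) (use gt in simp)
  moreover have le: "card (E `` Y) - b \<le> 2" using at[OF Y] low by linarith
  ultimately have "b \<le> 2" by linarith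
  then have "b = 1" using \<open>odd b\<close> by presburger
  then obtain y where y: "Y = {y}" using at[OF Y] by (metis card_1_singletonE)
  then have "card (E `` Y) = k" using degree YV by auto
  then show False using le \<open>b = 1\<close> k by simp
qed

text \<open>
  In other words, a connected 4-regular graph of this kind has no vertex cut with fewer than four
  vertices. The argument of \<open>card_nbrs_ge\<close>, for closed neighbourhoods, leaves one more case: blocks of
  size three with excess three. Then the closed neighbourhood of a block is the union of two
  blocks, hence closed under adjacency.
\<close>
lemma card_closed_nbrs_ge:
  assumes Y0: "Y0 \<subseteq> V" "Y0 \<noteq> {}" "Y0 \<union> E `` Y0 \<noteq> V" and k: "k = 4"
  shows "card Y0 + 4 \<le> card (Y0 \<union> E `` Y0)"
proof (rule ccontr)
  assume "\<not> ?thesis"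
  then have low: "card (Y0 \<union> E `` Y0) \<le> card Y0 + 3" by simp
  let ?R = "E \<union> Id_on V"
  have autR: "aut V ?R f" if "aut V E f" for f
  proof -
    have "inj_on f V" "f ` V = V" using that unfolding aut_def bij_betw_def by auto
    then have "(f x, f y) \<in> Id_on V \<longleftrightarrow> (x, y) \<in> Id_on V" if "x \<in> V" "y \<in> V" for x y
      using that by (auto dest: inj_onD)
    then show ?thesis using that unfolding aut_def by simp
  qed
  interpret R: transitive_relation V ?R
  proof
    show "finite V" "V \<noteq> {}" by (rule finite_V, rule nonempty_V)
    show "?R \<subseteq> V \<times> V" using R_sub by auto
    show "sym ?R" using sym_R by (auto simp: sym_def)
    show "\<exists>f. aut V ?R f \<and> f x = y" if "x \<in> V" "y \<in> V" for x y
      using transitive[OF that] autR by blast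
  qed
  have RIm: "?R `` Y = Y \<union> E `` Y" if "Y \<subseteq> V" for Y using that by auto
  obtain P b where P: "R.block_system P"
    and at: "\<And>Y. Y \<in> P \<Longrightarrow> card Y = b \<and> ?R `` Y \<noteq> V \<and> card (?R `` Y) + card Y0 \<le> card (?R `` Y0) + b"
    and un: "\<And>Y Z. Y \<in> P \<Longrightarrow> Z \<in> P \<Longrightarrow> Z \<subseteq> ?R `` Y \<or> Z \<inter> ?R `` Y = {}"
    using R.expansion_atoms[OF Y0(1,2)] Y0(3) unfolding RIm[OF Y0(1)] by blast
  note PV = R.block_systemD(2)[OF P] and Pne = R.block_systemD(3)[OF P]
  have finP: "finite Y" if "Y \<in> P" for Y using PV[OF that] finite_sub by auto
  have finR: "finite (?R `` Y)" for Y using finite_sub[OF R.Image_sub] .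
  have le: "card (?R `` Y) \<le> b + 3" if "Y \<in> P" for Y
    using at[OF that] low unfolding RIm[OF Y0(1)] by linarith
  have self: "Y \<subseteq> ?R `` Y" if "Y \<in> P" for Y using RIm[OF PV[OF that]] by auto
  obtain Y where Y: "Y \<in> P" using R.block_systemD(1)[OF P] by auto
  have "b dvd card V" by (rule R.block_system_dvd[OF P]) (use at PV in auto)
  then have "odd b" using odd_order by (meson dvd_trans)
  have "Y \<noteq> ?R `` Y"
  proof
    assume eq: "Y = ?R `` Y"
    then have "Y = V" using PV[OF Y] Pne[OF Y] by (intro connected) auto
    then show False using at[OF Y] eq by simp
  qed
  then have gt: "b < card (?R `` Y)"
    using psubset_card_mono[OF finR, of Y Y] self[OF Y] at[OF Y] by auto
  have "b dvd card (?R `` Y)"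
    by (rule R.block_system_dvd[OF P _ R.Image_sub un[OF Y]]) (use at in auto)
  then have "b dvd card (?R `` Y) - b" by simp
  then have "b \<le> card (?R `` Y) - b" by (rule dvd_imp_le) (use gt in simp)
  then have "b \<le> 3" using le[OF Y] by linarith
  have "b \<noteq> 1"
  proof
    assume "b = 1"
    then obtain y where y: "Y = {y}" using at[OF Y] by (metis card_1_singletonE)
    have "y \<notin> E `` {y}" using irrefl_E by (auto simp: irrefl_def)
    then have "card (?R `` Y) = 5"
      using RIm[OF PV[OF Y]] degree[of y] PV[OF Y] finite_sub[OF Image_sub, of "{y}"] k
      unfolding y by simp
    then show False using le[OF Y] \<open>b = 1\<close> by simp
  qed
  then have b: "b = 3" using \<open>b \<le> 3\<close> \<open>odd b\<close> by presburger
  obtain z where z: "z \<in> ?R `` Y" "z \<notin> Y" using self[OF Y] \<open>Y \<noteq> ?R `` Y\<close> by blast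
  then have "z \<in> V" using R.Image_sub by blast
  then obtain Z where Z: "Z \<in> P" "z \<in> Z" using R.block_system_cover[OF P] by blast
  have disj: "Y \<inter> Z = {}" using R.block_systemD(4)[OF P Y Z(1)] Z(2) z(2) by blast
  have ZY: "Z \<subseteq> ?R `` Y" using un[OF Y Z(1)] Z(2) z(1) by blast
  obtain y where y: "y \<in> Y" "(y, z) \<in> ?R" using z(1) by blast
  then have "(z, y) \<in> ?R" using R.sym_R by (meson symD)
  then have YZ: "Y \<subseteq> ?R `` Z" using un[OF Z(1) Y] Z(2) y(1) by blast
  have c: "card (Y \<union> Z) = 6"
    using card_Un_disjoint[OF finP[OF Y] finP[OF Z(1)] disj] at[OF Y] at[OF Z(1)] b by simp
  have "Y \<union> Z = ?R `` Y"
    by (rule card_seteq[OF finR]) (use self[OF Y] ZY c le[OF Y] b in auto)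
  moreover have "Y \<union> Z = ?R `` Z"
    by (rule card_seteq[OF finR]) (use self[OF Z(1)] YZ c le[OF Z(1)] b in auto)
  ultimately have "E `` (Y \<union> Z) \<subseteq> Y \<union> Z" by blast
  then have "Y \<union> Z = V" using PV[OF Y] PV[OF Z(1)] Pne[OF Y] by (intro connected) auto
  then show False using at[OF Y] \<open>Y \<union> Z = ?R `` Y\<close> by simp
qed

text \<open>
  The edges between \<open>X\<close> and the parts are counted from both sides, as described at the
  beginning; \<open>t\<close> is the number of parts with more than one vertex.
\<close>
theorem matchable_minus_three:
  assumes k: "4 \<le> k" and S: "S \<subseteq> V" "card S = 3"
  shows "matchable E (V - S)"
proof (rule ccontr)
  assume no: "\<not> matchable E (V - S)"
  have finS: "finite S" by (rule finite_sub[OF S(1)])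
  have "card (V - S) = card V - 3" "3 \<le> card V"
    using card_Diff_subset[OF finS S(1)] card_mono[OF finite_V S(1)] S(2) by auto
  then have "even (card (V - S))" using odd_order by simp
  then obtain T \<C> where T: "T \<subseteq> V - S" and op: "odd_parts E (V - S) T \<C>" and ex: "card T + 2 \<le> card \<C>"
    using tutte_barrier[OF _ sym_R _ no] finite_V by auto
  define X where "X = S \<union> T"
  have XV: "X \<subseteq> V" using S(1) T unfolding X_def by auto
  have finT: "finite T" using T finite_sub by blast
  have cX: "card X = card T + 3"
  proof -
    have "S \<inter> T = {}" using T by auto
    then show ?thesis using card_Un_disjoint[OF finS finT] S(2) unfolding X_def by simp
  qed
  have C: "odd (card C)" "C \<subseteq> V - X" "E `` C \<subseteq> C \<union> X" if "C \<in> \<C>" for C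
  proof -
    have *: "odd (card C)" "C \<subseteq> V - S - T" "E `` C \<inter> (V - S) \<subseteq> C \<union> T"
      using op that unfolding odd_parts_def by auto
    show "odd (card C)" "C \<subseteq> V - X" using * unfolding X_def by auto
    show "E `` C \<subseteq> C \<union> X" using *(3) Image_sub[of C] unfolding X_def by blast
  qed
  have disj: "pairwise disjnt \<C>" using op unfolding odd_parts_def by simp
  have finC: "finite \<C>" using odd_parts_finite[OF op] finite_V by simp
  have Csmall: "card C + 3 \<le> card V" if "C \<in> \<C>" for C
  proof -
    have "card (C \<union> X) \<le> card V" using C(2)[OF that] XV by (intro card_mono finite_V) auto
    moreover have "card (C \<union> X) = card C + card X"
      using C(2)[OF that] XV finite_sub by (intro card_Un_disjoint) blast+
    ultimately show ?thesis using cX by simp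
  qed
  define Big where "Big = {C \<in> \<C>. card C \<noteq> 1}"
  define Y where "Y = {y. {y} \<in> \<C>}"
  define t where "t = card Big"
  have split: "\<C> = Big \<union> (\<lambda>y. {y}) ` Y" "Big \<inter> (\<lambda>y. {y}) ` Y = {}"
    unfolding Big_def Y_def by (auto simp: card_1_singleton_iff)
  have finY: "finite Y" "finite Big"
    using finC split(1) by (auto dest: finite_imageD simp: inj_on_def)
  have cC: "card \<C> = t + card Y"
    using card_Un_disjoint[OF finY(2) _ split(2)] finY(1) split(1)
    unfolding t_def by (simp add: card_image)
  have Big3: "3 \<le> card C" if "C \<in> Big" for C
  proof -
    have "odd (card C)" "card C \<noteq> 1" using that C unfolding Big_def by auto
    then show ?thesis by presburger
  qed
  have BigC: "C \<in> \<C>" if "C \<in> Big" for C using that unfolding Big_def by simp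
  have YC: "y \<in> V" "E `` {y} \<subseteq> X" if "y \<in> Y" for y
  proof -
    have "{y} \<in> \<C>" using that unfolding Y_def by simp
    then show "y \<in> V" "E `` {y} \<subseteq> X" using C[of "{y}"] irrefl_E by (auto simp: irrefl_def)
  qed
  have cutX: "edge_cut C = links C X" if "C \<in> \<C>" for C
  proof -
    have "E \<inter> C \<times> (V - C) = E \<inter> C \<times> X" using C[OF that] XV by blast
    then show ?thesis unfolding edge_cut_def links_def by simp
  qed
  have "(\<Sum>C\<in>\<C>. links C X) = links (\<Union>\<C>) X"
  proof -
    have "links (\<Union>\<D>) X = (\<Sum>C\<in>\<D>. links C X)" if "\<D> \<subseteq> \<C>" for \<D>
      using finite_subset[OF that finC] that
    proof (induction \<D> rule: finite_induct)
      case empty then show ?case by (simp add: links_def)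
    next
      case (insert D \<D>)
      have "disjnt D D'" if "D' \<in> \<D>" for D'
        using pairwiseD[OF disj, of D D'] insert.prems insert.hyps(2) that by auto
      then have "D \<inter> \<Union>\<D> = {}" by (auto simp: disjnt_iff)
      then have "links X (D \<union> \<Union>\<D>) = links X D + links X (\<Union>\<D>)" by (rule links_Un_right)
      then show ?case using insert by (simp add: links_commute[of _ X])
    qed
    then show ?thesis by simp
  qed
  also have "\<dots> \<le> links (V - X) X" using C(2) by (intro links_mono) auto
  also have "links (V - X) X = edge_cut X" unfolding edge_cut_def by (rule links_commute)
  finally have sum: "(\<Sum>C\<in>\<C>. edge_cut C) + links X X \<le> k * card X"
    using cut_plus_links[OF XV] cutX by simp
  have cut1: "edge_cut {y} = k" if "y \<in> Y" for y
    using cut_plus_links[of "{y}"] links_inside_le[of "{y}"] YC(1)[OF that] by simp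
  have "(\<Sum>C\<in>\<C>. edge_cut C) = (\<Sum>C\<in>Big. edge_cut C) + (\<Sum>C\<in>(\<lambda>y. {y}) ` Y. edge_cut C)"
    by (subst split(1), rule sum.union_disjoint) (use finY split in auto)
  also have "(\<Sum>C\<in>(\<lambda>y. {y}) ` Y. edge_cut C) = k * card Y"
    using cut1 by (simp add: sum.reindex inj_on_def)
  finally have "(\<Sum>C\<in>Big. edge_cut C) + k * card Y + links X X \<le> k * card X" using sum by simp
  also have "\<dots> \<le> k * (t + card Y + 1)" using cX ex cC by (intro mult_left_mono) auto
  finally have bound: "(\<Sum>C\<in>Big. edge_cut C) + links X X \<le> k * t + k"
    by (simp add: algebra_simps)
  have cutBig: "2 * k - 2 \<le> edge_cut C" if "C \<in> Big" for C
  proof -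
    have "C \<subseteq> V" using C(2)[OF BigC[OF that]] by auto
    then show ?thesis using cut_ge[of C] Big3[OF that] Csmall[OF BigC[OF that]] k by auto
  qed
  have "t * (2 * k - 2) \<le> (\<Sum>C\<in>Big. edge_cut C)"
    using sum_bounded_below[of Big "2 * k - 2" edge_cut] cutBig unfolding t_def by simp
  then have tk: "t * (2 * k - 2) \<le> k * t + k" using bound by linarith
  \<comment> \<open>Cancelling \<open>k * t\<close> leaves \<open>t(k - 2) \<le> k\<close>, so \<open>t \<ge> 3\<close> would give \<open>k \<le> 3\<close>.\<close>
  obtain j where j: "k = j + 4" using k by (metis le_add_diff_inverse2)
  have tj: "t * (j + 2) \<le> j + 4" using tk unfolding j by (simp add: algebra_simps)
  have "t < 3"
  proof (rule ccontr)
    assume "\<not> t < 3"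
    then have "3 * (j + 2) \<le> t * (j + 2)" by (intro mult_right_mono) auto
    then show False using tj by simp
  qed
  \<comment> \<open>For nonempty \<open>Y\<close>, this compares \<open>|Y| + 3 \<le> |N(Y)| \<le> |X|\<close> with \<open>|X| \<le> |Y| + t + 1\<close>.\<close>
  moreover have "2 \<le> t"
  proof (cases "Y = {}")
    case True then show ?thesis using cX ex cC by simp
  next
    case False
    have "E `` Y \<subseteq> X" using YC(2) by auto
    moreover have "X \<noteq> V" using False C(2) unfolding Y_def by auto
    moreover have "Y \<subseteq> V" using YC(1) by auto
    ultimately have "card Y + 3 \<le> card (E `` Y)" "card (E `` Y) \<le> card X"
      using False XV finite_sub[OF XV] by (auto intro!: card_nbrs_ge[OF _ _ _ k] card_mono)
    then show ?thesis using cX ex cC by linarith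
  qed
  ultimately have t: "t = 2" by simp
  then have k4: "k = 4" using tj j by simp
  obtain C D where CD: "Big = {C, D}" "C \<noteq> D" using t unfolding t_def by (meson card_2_iff)
  have "edge_cut C + edge_cut D + links X X \<le> 12" using bound CD t k4 by simp
  moreover have "6 \<le> edge_cut C" "6 \<le> edge_cut D" using cutBig CD k4 by auto
  ultimately have cutC: "edge_cut C \<le> 6" and indep: "links X X = 0" by auto
  have CC: "C \<in> \<C>" "D \<in> \<C>" "C \<in> Big" "D \<in> Big" using CD BigC by auto
  have CV: "C \<subseteq> V" "C \<noteq> {}" "D \<noteq> {}" using C(2) CC Big3 by fastforce+
  show False
  proof (cases "Y = {}")
    case True
    have sub: "C \<union> E `` C \<subseteq> C \<union> X" using C(3)[OF CC(1)] by auto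
    have "D \<inter> (C \<union> X) = {}"
      using C(2)[OF CC(2)] pairwiseD[OF disj CC(2,1)] CD(2) unfolding disjnt_def by auto
    then have ne: "C \<union> E `` C \<noteq> V" using sub CV(3) C(2)[OF CC(2)] by blast
    have "card (C \<union> E `` C) \<le> card (C \<union> X)"
      using sub CV XV finite_sub by (intro card_mono) blast+
    also have "\<dots> \<le> card C + card X" by (rule card_Un_le)
    also have "card X \<le> 3" using True cX ex cC t by simp
    finally show False using card_closed_nbrs_ge[OF CV(1,2) ne k4] by simp
  next
    case False
    then obtain y where y: "y \<in> Y" by auto
    obtain a b c where tri: "(a, b) \<in> E" "(b, c) \<in> E" "(a, c) \<in> E"
      using ex_triangle[OF CV(1) Big3[OF CC(3)] Csmall[OF CC(1)] cutC k4] by blast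
    have abc: "a \<in> V" "b \<in> V" "c \<in> V" using tri R_memD by auto
    then obtain f where f: "aut V E f" "f a = y" using transitive YC(1)[OF y] by blast
    then have "(y, f b) \<in> E" "(f b, f c) \<in> E" "(y, f c) \<in> E"
      using tri abc unfolding aut_def by auto
    then have "(f b, f c) \<in> E \<inter> X \<times> X" using YC(2)[OF y] by auto
    then show False using indep finite_E unfolding links_def by (auto simp: card_eq_0_iff)
  qed
qed

end

section \<open>Cycles\<close>

text \<open>
  Walk through the graph without ever turning back. At the first repetition the walk is back at its
  start, because every other vertex on it already has its two neighbours on the walk. The
  vertices met so far are closed under adjacency, hence all of \<open>V\<close>.
\<close>
lemma two_regular_connected_cyclic_order:
  assumes fin: "finite V" and ne: "V \<noteq> {}" and E: "E \<subseteq> V \<times> V" "sym E" "irrefl E"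
    and connected: "\<And>A. A \<subseteq> V \<Longrightarrow> A \<noteq> {} \<Longrightarrow> E `` A \<subseteq> A \<Longrightarrow> A = V"
    and degree: "\<And>x. x \<in> V \<Longrightarrow> card (E `` {x}) = 2"
  obtains p where "bij_betw p {..<card V} V" and "3 \<le> card V"
    and "\<And>i j. i < card V \<Longrightarrow> j < card V \<Longrightarrow>
      (p i, p j) \<in> E \<longleftrightarrow> j = Suc i mod card V \<or> i = Suc j mod card V"
proof -
  have sym: "(y, x) \<in> E" if "(x, y) \<in> E" for x y using E(2) that by (meson symD)
  have loop: "(x, x) \<notin> E" for x using E(3) by (auto simp: irrefl_def)
  have inV: "x \<in> V" "y \<in> V" if "(x, y) \<in> E" for x y using E(1) that by auto
  have other: "\<exists>z. (y, z) \<in> E \<and> z \<noteq> x" if "y \<in> V" for x y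
  proof (rule ccontr)
    assume "\<not> ?thesis"
    then have "E `` {y} \<subseteq> {x}" by auto
    then have "card (E `` {y}) \<le> card {x}" by (intro card_mono) auto
    then show False using degree[OF that] by simp
  qed
  obtain x0 where x0: "x0 \<in> V" using ne by auto
  obtain x1 where x1: "(x0, x1) \<in> E" using other[OF x0] by blast
  \<comment> \<open>The walk as a sequence of arcs, since the next step depends on the previous one.\<close>
  have "\<exists>f. \<forall>n. f n \<in> E \<and> (fst (f (Suc n)) = snd (f n) \<and> snd (f (Suc n)) \<noteq> fst (f n))"
  proof (rule dependent_nat_choice)
    show "\<exists>e. e \<in> E" using x1 by blast
    fix e :: "'a \<times> 'a" and n :: nat
    assume "e \<in> E"
    then have "snd e \<in> V" using inV(2)[of "fst e" "snd e"] by simp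
    then obtain z where "(snd e, z) \<in> E" "z \<noteq> fst e" using other by blast
    then show "\<exists>e'. e' \<in> E \<and> (fst e' = snd e \<and> snd e' \<noteq> fst e)"
      by (intro exI[of _ "(snd e, z)"]) simp
  qed
  then obtain f where f: "f n \<in> E" "fst (f (Suc n)) = snd (f n)" "snd (f (Suc n)) \<noteq> fst (f n)" for n
    by blast
  define p where "p n = fst (f n)" for n
  have edge: "(p n, p (Suc n)) \<in> E" for n
    using f(1)[of n] f(2)[of n] unfolding p_def by (metis prod.collapse)
  have turn: "p (Suc (Suc n)) \<noteq> p n" for n
    using f(2)[of "Suc n"] f(3)[of n] unfolding p_def by simp
  have pV: "p n \<in> V" for n using inV(1)[OF edge] .
  have two: "E `` {x} = {y, z}" if "(x, y) \<in> E" "(x, z) \<in> E" "y \<noteq> z" for x y z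
  proof -
    have "finite (E `` {x})" using E(1) fin by (intro finite_subset[OF _ fin]) auto
    moreover have "card (E `` {x}) = 2" using degree inV(1)[OF that(1)] by simp
    moreover have "card {y, z} = 2" using that(3) by simp
    ultimately show ?thesis using that by (intro card_seteq[symmetric]) auto
  qed
  have nb: "E `` {p (Suc n)} = {p n, p (Suc (Suc n))}" for n
    using two[OF sym[OF edge[of n]] edge[of "Suc n"]] turn[of n] by metis
  have "\<exists>m. \<exists>j<m. p m = p j"
  proof (rule ccontr)
    assume a: "\<not> ?thesis"
    have "inj p"
    proof (rule injI)
      fix i j assume "p i = p j"
      then show "i = j" using a by (metis linorder_neqE_nat)
    qed
    moreover have "finite (range p)" using pV finite_subset[OF _ fin] by blast
    ultimately show False using finite_imageD by blast
  qed
  then obtain m where m: "\<exists>j<m. p m = p j" and least: "\<And>l. l < m \<Longrightarrow> \<not> (\<exists>j<l. p l = p j)"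
    using exists_least_iff[of "\<lambda>m. \<exists>j<m. p m = p j"] by auto
  have inj: "i = j" if "i < m" "j < m" "p i = p j" for i j
    using least[OF that(1)] least[OF that(2)] that(3) by (metis linorder_neqE_nat)
  obtain j where j: "j < m" "p m = p j" using m by blast
  have j0: "j = 0"
  proof (rule ccontr)
    assume "j \<noteq> 0"
    then obtain i where i: "j = Suc i" by (cases j) auto
    obtain l where l: "m = Suc l" using j(1) by (cases m) auto
    have "p l \<in> E `` {p j}" using sym[OF edge[of l]] j(2) l by simp
    then have "p l = p i \<or> p l = p (Suc j)" using nb[of i] i by simp
    then show False
    proof
      assume "p l = p i"
      then have "l = i" using inj[of l i] l i j(1) by simp
      then show False using l i j(1) by simp
    next
      assume a: "p l = p (Suc j)"
      show False
      proof (cases "Suc j < m")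
        case True
        then have "l = Suc j" using inj[of l "Suc j"] a l by simp
        then show False using turn[of j] j(2) l by simp
      next
        case False
        then have "p (Suc j) = p j" using j l by (simp add: less_Suc_eq)
        then show False using edge[of j] loop by simp
      qed
    qed
  qed
  have "m \<noteq> 0" "m \<noteq> 1" "m \<noteq> 2"
    using j j0 edge[of 0] loop turn[of 0] by (auto simp: numeral_2_eq_2)
  then have m3: "3 \<le> m" by simp
  define pred where "pred i = (if i = 0 then m - 1 else i - 1)" for i
  have nbm: "E `` {p i} = {p (pred i), p (Suc i mod m)}" if i: "i < m" for i
  proof -
    have Sm: "p (Suc i mod m) = p (Suc i)"
    proof (cases "Suc i = m")
      case True then show ?thesis using j j0 by simp
    next
      case False then show ?thesis using i by simp
    qed
    show ?thesis
    proof (cases i)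
      case 0
      have "(p (m - 1), p m) \<in> E" using edge[of "m - 1"] m3 by simp
      then have "(p 0, p (m - 1)) \<in> E" using sym j j0 by simp
      moreover have "p (m - 1) \<noteq> p 1" using inj[of "m - 1" 1] m3 by auto
      ultimately show ?thesis
        using two[of "p 0" "p (m - 1)" "p 1"] edge[of 0] Sm 0 unfolding pred_def by simp
    next
      case (Suc i')
      then show ?thesis using nb[of i'] Sm unfolding pred_def by simp
    qed
  qed
  have predm: "pred i < m" "Suc i mod m < m" if "i < m" for i
    using that m3 unfolding pred_def by auto
  have "p ` {..<m} = V"
  proof (rule connected)
    show "p ` {..<m} \<subseteq> V" using pV by auto
    show "p ` {..<m} \<noteq> {}" using m3 by (simp add: lessThan_empty_iff)
    show "E `` (p ` {..<m}) \<subseteq> p ` {..<m}"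
    proof
      fix y assume "y \<in> E `` (p ` {..<m})"
      then obtain i where i: "i < m" "y \<in> E `` {p i}" by auto
      then show "y \<in> p ` {..<m}" using nbm[OF i(1)] predm[OF i(1)] by auto
    qed
  qed
  moreover have "inj_on p {..<m}" using inj by (auto intro: inj_onI)
  ultimately have bij: "bij_betw p {..<m} V" unfolding bij_betw_def by simp
  then have mV: "m = card V" using bij_betw_same_card by fastforce
  have adj: "(p i, p j) \<in> E \<longleftrightarrow> j = Suc i mod m \<or> i = Suc j mod m" if ij: "i < m" "j < m" for i j
  proof -
    have "(p i, p j) \<in> E \<longleftrightarrow> p j = p (pred i) \<or> p j = p (Suc i mod m)"
      using nbm[OF ij(1)] by blast
    also have "\<dots> \<longleftrightarrow> j = pred i \<or> j = Suc i mod m"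
      using inj[OF ij(2)] predm[OF ij(1)] by auto
    also have "j = pred i \<longleftrightarrow> i = Suc j mod m"
      using ij unfolding pred_def by (cases "Suc j = m") auto
    finally show ?thesis by blast
  qed
  show ?thesis
    by (rule that[of p]) (use bij m3 adj mV in auto)
qed

lemma cycle_graph_nbrs_of_0:
  assumes "(0, j) \<in> parcs (cycle_graph n)"
  shows "j \<in> {1, n - 1}"
  using assms unfolding cycle_graph_def by (cases "Suc j = n") (auto simp: mod_Suc split: if_splits)

lemma is_cycle_low_degree:
  assumes "is_cycle G"
  shows "\<exists>v\<in>verts G. card (arcs_ends G `` {v}) \<le> 2"
proof -
  obtain n f where n: "3 \<le> n" and f: "pre_digraph.digraph_isomorphism G f"
    and H: "with_proj (cycle_graph n) = app_iso f G"
    using assms unfolding is_cycle_def digraph_iso_def by auto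
  have wf: "wf_digraph G" and inj: "inj_on (iso_verts f) (verts G)"
    using f unfolding pre_digraph.digraph_isomorphism_def by auto
  have "{..<n} = verts (with_proj (cycle_graph n))" by (simp add: cycle_graph_def)
  also have "\<dots> = iso_verts f ` verts G" unfolding H by simp
  finally have "0 \<in> iso_verts f ` verts G" using n by (metis lessThan_iff less_le_trans zero_less_numeral)
  then obtain v where v: "v \<in> verts G" "iso_verts f v = 0" by auto
  have "iso_verts f ` (arcs_ends G `` {v}) \<subseteq> {1, n - 1}"
  proof
    fix j assume "j \<in> iso_verts f ` (arcs_ends G `` {v})"
    then obtain u where u: "(v, u) \<in> arcs_ends G" "j = iso_verts f u" by auto
    then have "(0, j) \<in> arcs_ends (with_proj (cycle_graph n))"
      unfolding H wf_digraph.arcs_ends_app_iso_eq[OF wf f] using v(2)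
      by (auto intro!: image_eqI[of _ _ "(v, u)"])
    then show "j \<in> {1, n - 1}" using cycle_graph_nbrs_of_0 by simp
  qed
  then have "card (iso_verts f ` (arcs_ends G `` {v})) \<le> card {1, n - 1}" by (intro card_mono) auto
  also have "\<dots> \<le> 2" by (simp add: card_insert_if)
  finally have "card (iso_verts f ` (arcs_ends G `` {v})) \<le> 2" .
  moreover have "inj_on (iso_verts f) (arcs_ends G `` {v})"
    by (rule inj_on_subset[OF inj]) (use wf_digraph.adj_in_verts[OF wf] in auto)
  ultimately show ?thesis using v(1) by (auto simp: card_image)
qed

lemma is_cycleI:
  assumes G: "digraph G" and p: "bij_betw p {..<n} (verts G)" and n: "3 \<le> n"
    and adj: "\<And>i j. i < n \<Longrightarrow> j < n \<Longrightarrow>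
      (p i, p j) \<in> arcs_ends G \<longleftrightarrow> j = Suc i mod n \<or> i = Suc j mod n"
  shows "is_cycle G"
proof -
  interpret digraph G by (rule G)
  define q where "q = inv_into {..<n} p"
  have qbij: "bij_betw q (verts G) {..<n}" unfolding q_def by (rule bij_betw_inv_into[OF p])
  have qp: "q (p i) = i" if "i < n" for i
    using that bij_betw_inv_into_left[OF p] unfolding q_def by simp
  have pq: "p (q v) = v" if "v \<in> verts G" for v
    using that bij_betw_inv_into_right[OF p] unfolding q_def by simp
  have qn: "q v < n" if "v \<in> verts G" for v using qbij that unfolding bij_betw_def by auto
  define h where "h a = (q (tail G a), q (head G a))" for a
  let ?f = "\<lparr>iso_verts = q, iso_arcs = h, iso_head = snd, iso_tail = fst\<rparr>"
  have "inj_on h (arcs G)"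
  proof (rule inj_onI)
    fix a b assume ab: "a \<in> arcs G" "b \<in> arcs G" "h a = h b"
    then have "q (tail G a) = q (tail G b)" "q (head G a) = q (head G b)" unfolding h_def by auto
    then have "tail G a = tail G b" "head G a = head G b"
      using qbij ab unfolding bij_betw_def by (auto dest: inj_onD)
    then show "a = b" using no_multi_arcs[OF ab(1,2)] unfolding arc_to_ends_def by simp
  qed
  then have iso: "digraph_isomorphism ?f"
    unfolding digraph_isomorphism_def using qbij wf_digraph
    by (auto simp: bij_betw_def h_def)
  have "h ` arcs G = (\<lambda>(u, v). (q u, q v)) ` arcs_ends G"
    unfolding arcs_ends_conv h_def by (auto simp: image_image)
  also have "\<dots> = parcs (cycle_graph n)"
  proof (intro equalityI subsetI)
    fix e assume "e \<in> (\<lambda>(u, v). (q u, q v)) ` arcs_ends G"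
    then obtain u v where uv: "(u, v) \<in> arcs_ends G" "e = (q u, q v)" by auto
    have "u \<in> verts G" "v \<in> verts G" using adj_in_verts uv(1) by auto
    then show "e \<in> parcs (cycle_graph n)"
      using adj[of "q u" "q v"] pq qn uv unfolding cycle_graph_def by auto
  next
    fix e assume "e \<in> parcs (cycle_graph n)"
    then obtain i j where ij: "e = (i, j)" "i < n" "j < n" "j = Suc i mod n \<or> i = Suc j mod n"
      unfolding cycle_graph_def by auto
    then have "(p i, p j) \<in> arcs_ends G" using adj by blast
    then show "e \<in> (\<lambda>(u, v). (q u, q v)) ` arcs_ends G"
      using ij qp by (auto intro!: image_eqI[of _ _ "(p i, p j)"])
  qed
  finally have "with_proj (cycle_graph n) = app_iso ?f G"
    using qbij by (auto simp: app_iso_def with_proj_def bij_betw_def cycle_graph_def)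
  then show ?thesis unfolding is_cycle_def digraph_iso_def using iso n by blast
qed

section \<open>From digraphs to relations\<close>

lemma edges_conv: "edges G = {{x, y} | x y. (x, y) \<in> arcs_ends G}"
  unfolding edges_def arcs_ends_conv by auto

lemma perfect_matching_induce_iff:
  assumes "W \<subseteq> verts G"
  shows "(\<exists>M. perfect_matching (G \<restriction> W) M) \<longleftrightarrow> matchable (arcs_ends G) W"
proof -
  define F where "F = edges G"
  have mem: "matchable (arcs_ends G) W \<longleftrightarrow> (\<exists>M. M \<subseteq> F \<and> pairwise disjnt M \<and> \<Union>M = W)"
    unfolding matchable_def F_def edges_conv ..
  have sub: "M \<subseteq> edges (G \<restriction> W) \<longleftrightarrow> M \<subseteq> F" if "\<Union>M = W" for M
  proof -
    have "edges (G \<restriction> W) = {m \<in> edges G. m \<subseteq> W}" unfolding edges_def by auto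
    moreover have "\<forall>m\<in>M. m \<subseteq> W" using that by auto
    ultimately show ?thesis unfolding F_def by blast
  qed
  have "perfect_matching (G \<restriction> W) M \<longleftrightarrow> M \<subseteq> F \<and> pairwise disjnt M \<and> \<Union>M = W" for M
    unfolding perfect_matching_def induce_subgraph_verts using sub[of M] by auto
  then show ?thesis unfolding mem by simp
qed

lemma automorphism_aut:
  assumes G: "wf_digraph G" and \<phi>: "automorphism G \<phi>"
  shows "aut (verts G) (arcs_ends G) (iso_verts \<phi>)"
proof -
  have iso: "pre_digraph.digraph_isomorphism G \<phi>" and eq: "app_iso \<phi> G = G"
    using \<phi> unfolding automorphism_def by auto
  have im: "iso_verts \<phi> ` verts G = verts G" using eq verts_app_iso by metis
  have inj: "inj_on (iso_verts \<phi>) (verts G)"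
    by (rule pre_digraph.digraph_isomorphism_inj_on_verts[OF iso])
  have E: "arcs_ends G = (\<lambda>(u, v). (iso_verts \<phi> u, iso_verts \<phi> v)) ` arcs_ends G"
    using wf_digraph.arcs_ends_app_iso_eq[OF G iso] eq by simp
  have "(iso_verts \<phi> x, iso_verts \<phi> y) \<in> arcs_ends G \<longleftrightarrow> (x, y) \<in> arcs_ends G"
    if xy: "x \<in> verts G" "y \<in> verts G" for x y
  proof
    assume "(x, y) \<in> arcs_ends G"
    then show "(iso_verts \<phi> x, iso_verts \<phi> y) \<in> arcs_ends G"
      by (subst E) (auto intro!: image_eqI[of _ _ "(x, y)"])
  next
    assume "(iso_verts \<phi> x, iso_verts \<phi> y) \<in> arcs_ends G"
    then obtain u v where uv: "(u, v) \<in> arcs_ends G"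
      "iso_verts \<phi> x = iso_verts \<phi> u" "iso_verts \<phi> y = iso_verts \<phi> v"
      by (subst (asm) E) auto
    have "u \<in> verts G" "v \<in> verts G" using wf_digraph.adj_in_verts[OF G uv(1)] by auto
    then have "x = u" "y = v" using uv xy inj by (auto dest: inj_onD)
    then show "(x, y) \<in> arcs_ends G" using uv by simp
  qed
  then show ?thesis unfolding aut_def bij_betw_def using inj im by simp
qed

lemma connected_closed_set:
  assumes G: "wf_digraph G" "symmetric G" "Digraph_Component.connected G"
    and A: "A \<subseteq> verts G" "A \<noteq> {}" "arcs_ends G `` A \<subseteq> A"
  shows "A = verts G"
proof
  interpret wf_digraph G by (rule G(1))
  show "verts G \<subseteq> A"
  proof
    fix v assume v: "v \<in> verts G"
    obtain u where u: "u \<in> A" using A(2) by auto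
    have "u \<rightarrow>\<^sup>*\<^bsub>G\<^esub> v"
      using symmetric_connected_imp_strongly_connected[OF G(2,3)] u v A(1)
      unfolding strongly_connected_def by auto
    then show "v \<in> A"
    proof (induction rule: reachable_induct)
      case base show ?case by (rule u)
    next
      case (step x y) then show ?case using A(3) by blast
    qed
  qed
qed (rule A(1))

text \<open>A vertex with fewer than \<open>p\<close> neighbours becomes isolated when these and some further vertices are deleted.\<close>
lemma factor_critical_degree:
  assumes crit: "factor_critical p G" and G: "Digraph.graph G"
    and p: "p < card (verts G)" and v: "v \<in> verts G"
  shows "p \<le> card (arcs_ends G `` {v})"
proof (rule ccontr)
  interpret Digraph.graph G by (rule G)
  let ?N = "arcs_ends G `` {v}"
  assume "\<not> p \<le> card ?N"
  moreover have "?N \<subseteq> verts G - {v}" using adj_in_verts adj_not_same by auto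
  moreover have "p \<le> card (verts G - {v})" using p v by simp
  ultimately obtain S where S: "?N \<subseteq> S" "S \<subseteq> verts G - {v}" "card S = p"
    using exists_subset_between[of ?N p "verts G - {v}"] by auto
  have "S \<subseteq> verts G" using S(2) by auto
  then have "matchable (arcs_ends G) (verts G - S)"
    using crit S(3) perfect_matching_induce_iff[of "verts G - S" G] unfolding factor_critical_def by auto
  then obtain M where M: "M \<subseteq> {{x, y} | x y. (x, y) \<in> arcs_ends G}" "\<Union>M = verts G - S"
    unfolding matchable_def by blast
  have "v \<in> \<Union>M" using M(2) v S(2) by auto
  then obtain x y where xy: "v \<in> {x, y}" "(x, y) \<in> arcs_ends G" "{x, y} \<in> M" using M(1) by blast
  then have "x \<notin> S" "y \<notin> S" using M(2) by auto
  moreover have "(y, x) \<in> arcs_ends G" using arcs_ends_symmetric[OF sym_arcs xy(2)] .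
  ultimately show False using xy(1,2) S(1) by auto
qed

section \<open>Characterization of 3-factor-critical graphs\<close>

theorem theorem1p4:
  fixes G :: "('a, 'b) pre_digraph"
  assumes "Digraph.graph G"
    and "Digraph_Component.connected G"
    and "vertex_transitive G"
    and "odd (card (verts G))"
    and "card (verts G) \<ge> 5"
  shows "factor_critical 3 G \<longleftrightarrow> \<not> is_cycle G"
proof
  interpret Digraph.graph G by (rule assms(1))
  assume crit: "factor_critical 3 G"
  show "\<not> is_cycle G"
  proof
    assume "is_cycle G"
    then obtain v where v: "v \<in> verts G" "card (arcs_ends G `` {v}) \<le> 2"
      using is_cycle_low_degree by blast
    then show False using factor_critical_degree[OF crit assms(1) _ v(1)] assms(5) by simp
  qed
next
  interpret Digraph.graph G by (rule assms(1))
  let ?V = "verts G" and ?E = "arcs_ends G"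
  assume no_cycle: "\<not> is_cycle G"
  have symE: "sym ?E" using sym_arcs unfolding symmetric_def .
  have irreflE: "irrefl ?E" using adj_not_same by (auto simp: irrefl_def)
  have subE: "?E \<subseteq> ?V \<times> ?V" using adj_in_verts by auto
  have ne: "?V \<noteq> {}" using assms(5) by auto
  have closed: "A = ?V" if "A \<subseteq> ?V" "A \<noteq> {}" "?E `` A \<subseteq> A" for A
    by (rule connected_closed_set[OF wf_digraph sym_arcs assms(2)]) (fact that)+
  interpret T: transitive_relation ?V ?E
  proof (rule transitive_relation.intro)
    show "\<exists>f. aut ?V ?E f \<and> f x = y" if xy: "x \<in> ?V" "y \<in> ?V" for x y
    proof -
      obtain \<phi> where "automorphism G \<phi>" "y = iso_verts \<phi> x"
        using assms(3)[unfolded vertex_transitive_def, rule_format, OF xy] by auto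
      then show ?thesis
        by (intro exI[of _ "iso_verts \<phi>"] conjI automorphism_aut[OF wf_digraph]) auto
    qed
  qed (fact finite_verts ne subE symE)+
  obtain k where k: "\<And>x. x \<in> ?V \<Longrightarrow> card (?E `` {x}) = k" using T.regular by blast
  interpret odd_transitive_graph ?V ?E k
    by unfold_locales (fact irreflE closed assms(4) k)+
  have "k \<noteq> 0"
  proof
    assume "k = 0"
    obtain x where x: "x \<in> ?V" using ne by auto
    have "finite (?E `` {x})" using T.finite_sub[OF T.Image_sub] .
    then have "?E `` {x} = {}" using k[OF x] \<open>k = 0\<close> by simp
    then have "{x} = ?V" using x by (intro closed) auto
    then have "card ?V = card {x}" by simp
    then show False using assms(5) by simp
  qed
  moreover have "k \<noteq> 2"
  proof
    assume "k = 2"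
    then have two: "\<And>x. x \<in> ?V \<Longrightarrow> card (?E `` {x}) = 2" using k by simp
    obtain p where p: "bij_betw p {..<card ?V} ?V" "3 \<le> card ?V"
      and adj: "\<And>i j. i < card ?V \<Longrightarrow> j < card ?V \<Longrightarrow>
        (p i, p j) \<in> ?E \<longleftrightarrow> j = Suc i mod card ?V \<or> i = Suc j mod card ?V"
      by (rule two_regular_connected_cyclic_order
          [OF finite_verts ne subE symE irreflE closed two]) blast+
    have "is_cycle G" by (rule is_cycleI[OF _ p adj]) (unfold_locales, auto)
    then show False using no_cycle by simp
  qed
  ultimately have "4 \<le> k" using even_degree by presburger
  show "factor_critical 3 G"
    unfolding factor_critical_def
  proof (intro conjI allI impI)
    show "even (3::nat) \<longleftrightarrow> even (card ?V)" using assms(4) by simp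
    fix S assume "S \<subseteq> ?V \<and> card S = 3"
    then have "matchable ?E (?V - S)" using matchable_minus_three[OF \<open>4 \<le> k\<close>] by simp
    then show "\<exists>M. perfect_matching (G \<restriction> (?V - S)) M"
      by (simp add: perfect_matching_induce_iff)
  qed
qed

end
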